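(* Let $\{w^k=(x^k,y^k,z^k)\}$ be any sequence generated by the algorithm imsPADMM (described in the context) applied to the problem $\min\{p(x)+f(x)+q(y)+g(y)\mid \mathcal A^*x+\mathcal B^*y=c\}$, and suppose that the solution set $\overline{\mathcal W}$ of the KKT system of this problem is nonempty. Assume that $$\Sigma_f+\mathcal S+\sigma\mathcal A\mathcal A^*\succ 0\quad\text{and}\quad \Sigma_g+\mathcal T+\sigma\mathcal B\mathcal B^*\succ 0 .$$ Then the linear operators $$\mathcal F:=\tfrac12\Sigma_f+\mathcal S+\tfrac{(1-\alpha)\sigma}{2}\mathcal A\mathcal A^*,\qquad \mathcal G:=\tfrac12\Sigma_g+\mathcal T+\min\{\tau,1+\tau-\tau^2\}\,\alpha\sigma\,\mathcal B\mathcal B^*$$ are positive definite, and the sequence $\{w^k\}$ converges to a point in $\overline{\mathcal W}$.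
   Context: Problem. Let $m,n\ge1$ be integers, let $\mathcal Z,\mathcal X_1,\dots,\mathcal X_m,\mathcal Y_1,\dots,\mathcal Y_n$ be finite dimensional real Euclidean spaces, $\mathcal X=\mathcal X_1\times\cdots\times\mathcal X_m$, $\mathcal Y=\mathcal Y_1\times\cdots\times\mathcal Y_n$, $\mathcal W=\mathcal X\times\mathcal Y\times\mathcal Z$. Let $p_1:\mathcal X_1\to(-\infty,\infty]$ and $q_1:\mathcal Y_1\to(-\infty,\infty]$ be closed proper convex functions, $p(x):=p_1(x_1)$, $q(y):=q_1(y_1)$; let $f:\mathcal X\to\mathbb R$ and $g:\mathcal Y\to\mathbb R$ be continuously differentiable convex functions with Lipschitz continuous gradients; let $\mathcal A:\mathcal Z\to\mathcal X$ and $\mathcal B:\mathcal Z\to\mathcal Y$ be linear with adjoints $\mathcal A^*,\mathcal B^*$, and $c\in\mathcal Z$. The problem is $\min_{x,y}\{p(x)+f(x)+q(y)+g(y)\mid \mathcal A^*x+\mathcal B^*y=c\}$. Its KKT solution set $\overline{\mathcal W}$ is the set of $(x,y,z)\in\mathcal W$ with $0\in\partial p(x)+\nabla f(x)+\mathcal A z$, $0\in\partial q(y)+\nabla g(y)+\mathcal B z$, $\mathcal A^*x+\mathcal B^*y=c$. Notation. For a self-adjoint positive semidefinite operator $\mathcal H$, $\|u\|_{\mathcal H}^2:=\langle u,\mathcal H u\rangle$ and $\mathcal H^{1/2}$ is its positive semidefinite square root. Majorization and minorization operators. $\widehat\Sigma_f,\Sigma_f$ on $\mathcal X$ and $\widehat\Sigma_g,\Sigma_g$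 on $\mathcal Y$ are fixed self-adjoint positive semidefinite linear operators with $\Sigma_f\preceq\widehat\Sigma_f$, $\Sigma_g\preceq\widehat\Sigma_g$ such that for all $x,x'\in\mathcal X$, $\tfrac12\|x-x'\|^2_{\Sigma_f}\le f(x)-f(x')-\langle\nabla f(x'),x-x'\rangle\le\tfrac12\|x-x'\|^2_{\widehat\Sigma_f}$, and for all $y,y'\in\mathcal Y$, $\tfrac12\|y-y'\|^2_{\Sigma_g}\le g(y)-g(y')-\langle\nabla g(y'),y-y'\rangle\le\tfrac12\|y-y'\|^2_{\widehat\Sigma_g}$. Algorithm imsPADMM. Parameters: $\sigma>0$; $\tau\in(0,(1+\sqrt5)/2)$; a summable sequence $\{\varepsilon_k\}_{k\ge0}$ of nonnegative numbers; self-adjoint positive semidefinite linear operators $\mathcal S:\mathcal X\to\mathcal X$, $\mathcal T:\mathcal Y\to\mathcal Y$ such that $\mathcal M:=\widehat\Sigma_f+\mathcal S+\sigma\mathcal A\mathcal A^*\succ0$ and $\mathcal N:=\widehat\Sigma_g+\mathcal T+\sigma\mathcal B\mathcal B^*\succ0$; an initial point $(x^0,y^0,z^0)\in\operatorname{dom}p\times\operatorname{dom}q\times\mathcal Z$. A sequence is generated by imsPADMM if for every $k\ge0$: (Step 1) $x^{k+1}\in\mathcal X$ and $d_x^k\in\partial\psi_k(x^{k+1})$ satisfy $\|\mathcal M^{-1/2}d_x^k\|\le\varepsilon_k$, where $\psi_k(x):=p(x)+\tfrac12\langle x,\mathcal Mx\rangle-\langle l_x^k,x\rangle$ and $-l_x^k:=\nabla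 f(x^k)+\mathcal Az^k-\mathcal Mx^k+\sigma\mathcal A(\mathcal A^*x^k+\mathcal B^*y^k-c)$; (Step 2) $y^{k+1}\in\mathcal Y$ and $d_y^k\in\partial\varphi_k(y^{k+1})$ satisfy $\|\mathcal N^{-1/2}d_y^k\|\le\varepsilon_k$, where $\varphi_k(y):=q(y)+\tfrac12\langle y,\mathcal Ny\rangle-\langle l_y^k,y\rangle$ and $-l_y^k:=\nabla g(y^k)+\mathcal Bz^k-\mathcal Ny^k+\sigma\mathcal B(\mathcal A^*x^{k+1}+\mathcal B^*y^k-c)$; (Step 3) $z^{k+1}:=z^k+\tau\sigma(\mathcal A^*x^{k+1}+\mathcal B^*y^{k+1}-c)$. Constant. $\alpha:=\tfrac12\bigl(1+\tau/\min\{1+\tau,1+\tau^{-1}\}\bigr)$. *)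

theory Defs
  imports "HOL-Analysis.Analysis"
begin

section \<open>Product spaces\<close>

text \<open>
  A product \<open>\<X>\<^sub>1 \<times> \<dots> \<times> \<X>\<^sub>m\<close> of finitely many Euclidean spaces of unrelated dimensions is
  given as an orthogonal direct sum: the blocks are pairwise orthogonal subspaces
  \<open>X 1, \<dots>, X m\<close> of one Euclidean space, jointly spanning it.  A block may be trivial.
\<close>

definition block_product :: "nat \<Rightarrow> (nat \<Rightarrow> 'a::euclidean_space set) \<Rightarrow> bool" where
  "block_product m X \<longleftrightarrow>
     1 \<le> m \<and>
     (\<forall>i\<in>{1..m}. subspace (X i)) \<and>
     (\<forall>i\<in>{1..m}. \<forall>j\<in>{1..m}. i \<noteq> j \<longrightarrow> (\<forall>u\<in>X i. \<forall>v\<in>X j. orthogonal u v)) \<and>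
     span (\<Union>i\<in>{1..m}. X i) = UNIV"

definition block_component :: "nat \<Rightarrow> (nat \<Rightarrow> 'a::euclidean_space set) \<Rightarrow> nat \<Rightarrow> 'a \<Rightarrow> 'a" where
  "block_component m X i x = (THE u. \<exists>v. (\<forall>j\<in>{1..m}. v j \<in> X j) \<and> x = (\<Sum>j=1..m. v j) \<and> u = v i)"

lemma block_component_sum:
  assumes X: "block_product m X" and v: "\<forall>j\<in>{1..m}. v j \<in> X j" and i: "i \<in> {1..m}"
  shows "block_component m X i (\<Sum>j=1..m. v j) = v i"
  unfolding block_component_def
proof (rule the_equality)
  fix u
  assume "\<exists>w. (\<forall>j\<in>{1..m}. w j \<in> X j) \<and> (\<Sum>j=1..m. v j) = (\<Sum>j=1..m. w j) \<and> u = w i"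
  then obtain w where w: "\<forall>j\<in>{1..m}. w j \<in> X j"
    and eq: "(\<Sum>j=1..m. v j) = (\<Sum>j=1..m. w j)" and u: "u = w i"
    by blast
  define d where "d j = v j - w j" for j
  have d: "d j \<in> X j" if "j \<in> {1..m}" for j
    using X v w that unfolding d_def block_product_def by (auto intro: subspace_diff)
  have "0 = (\<Sum>j=1..m. d j) \<bullet> d i"
    using eq by (simp add: d_def sum_subtractf)
  also have "\<dots> = (\<Sum>j=1..m. if j = i then d i \<bullet> d i else 0)"
    unfolding inner_sum_left
    by (rule sum.cong) (use X d i in \<open>auto simp: block_product_def orthogonal_def\<close>)
  also have "\<dots> = d i \<bullet> d i"
    using i by simp
  finally show "u = v i"
    by (simp add: u d_def)
qed (use v in blast)

lemma ex_block_sum: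
  assumes X: "block_product m X"
  shows "\<exists>v. (\<forall>j\<in>{1..m}. v j \<in> X j) \<and> x = (\<Sum>j=1..m. v j)"
proof -
  have sub: "subspace (X j)" if "j \<in> {1..m}" for j
    using X that by (auto simp: block_product_def)
  have "x \<in> span (\<Union>i\<in>{1..m}. X i)"
    using X by (simp add: block_product_def)
  then show ?thesis
  proof (induction rule: span_induct_alt)
    case base
    show ?case
      using sub by (intro exI[of _ "\<lambda>_. 0"]) (simp add: subspace_0)
  next
    case (step c b y)
    then obtain i v where i: "i \<in> {1..m}" "b \<in> X i"
      and v: "\<forall>j\<in>{1..m}. v j \<in> X j" "y = (\<Sum>j=1..m. v j)"
      by blast
    define w where "w j = (if j = i then c *\<^sub>R b else 0) + v j" for j
    have "\<forall>j\<in>{1..m}. w j \<in> X j"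
      using i v sub by (auto simp: w_def intro!: subspace_add subspace_scale)
    moreover have "c *\<^sub>R b + y = (\<Sum>j=1..m. w j)"
      using i v by (simp add: w_def sum.distrib)
    ultimately show ?case
      by blast
  qed
qed

section \<open>Extended-valued convex functions\<close>

definition epigraph_on :: "'a set \<Rightarrow> ('a \<Rightarrow> ereal) \<Rightarrow> ('a \<times> real) set" where
  "epigraph_on S h = {(u, r). u \<in> S \<and> h u \<le> ereal r}"

text \<open>Only the values of \<open>h\<close> on \<open>S\<close> matter.\<close>

definition closed_proper_convex_on :: "'a::euclidean_space set \<Rightarrow> ('a \<Rightarrow> ereal) \<Rightarrow> bool" where
  "closed_proper_convex_on S h \<longleftrightarrow>
     (\<forall>u\<in>S. h u \<noteq> -\<infinity>) \<and> (\<exists>u\<in>S. h u \<noteq> \<infinity>) \<and>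
     convex (epigraph_on S h) \<and> closed (epigraph_on S h)"

definition effective_dom :: "('a \<Rightarrow> ereal) \<Rightarrow> 'a set" where
  "effective_dom h = {u. h u < \<infinity>}"

definition subdifferential :: "('a::real_inner \<Rightarrow> ereal) \<Rightarrow> 'a \<Rightarrow> 'a set" where
  "subdifferential h u = {v. \<forall>u'. h u + ereal (v \<bullet> (u' - u)) \<le> h u'}"

section \<open>Self-adjoint operators\<close>

definition self_adjoint :: "('a::real_inner \<Rightarrow> 'a) \<Rightarrow> bool" where
  "self_adjoint H \<longleftrightarrow> linear H \<and> (\<forall>u v. H u \<bullet> v = u \<bullet> H v)"

definition psd_op :: "('a::real_inner \<Rightarrow> 'a) \<Rightarrow> bool" where
  "psd_op H \<longleftrightarrow> self_adjoint H \<and> (\<forall>u. 0 \<le> u \<bullet> H u)"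

definition pd_op :: "('a::real_inner \<Rightarrow> 'a) \<Rightarrow> bool" where
  "pd_op H \<longleftrightarrow> self_adjoint H \<and> (\<forall>u. u \<noteq> 0 \<longrightarrow> 0 < u \<bullet> H u)"

definition loewner_le :: "('a::real_inner \<Rightarrow> 'a) \<Rightarrow> ('a \<Rightarrow> 'a) \<Rightarrow> bool" where
  "loewner_le H K \<longleftrightarrow> psd_op (\<lambda>u. K u - H u)"

definition op_sqnorm :: "('a::real_inner \<Rightarrow> 'a) \<Rightarrow> 'a \<Rightarrow> real" where
  "op_sqnorm H u = u \<bullet> H u"

definition op_sqrt :: "('a::real_inner \<Rightarrow> 'a) \<Rightarrow> 'a \<Rightarrow> 'a" where
  "op_sqrt H = (THE R. psd_op R \<and> R \<circ> R = H)"

section \<open>Problem and algorithm\<close>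

text \<open>
  The argument \<open>p\<close> below is the function \<open>x \<mapsto> p\<^sub>1(x\<^sub>1)\<close> on the whole product space (similarly \<open>q\<close>),
  and \<open>Df\<close>, \<open>Dg\<close> are the gradient maps of \<open>f\<close> and \<open>g\<close>.
\<close>

definition KKT_solutions ::
  "('x::euclidean_space \<Rightarrow> ereal) \<Rightarrow> ('y::euclidean_space \<Rightarrow> ereal) \<Rightarrow> ('x \<Rightarrow> 'x) \<Rightarrow> ('y \<Rightarrow> 'y) \<Rightarrow>
   ('z::euclidean_space \<Rightarrow> 'x) \<Rightarrow> ('z \<Rightarrow> 'y) \<Rightarrow> 'z \<Rightarrow> ('x \<times> 'y \<times> 'z) set" where
  "KKT_solutions p q Df Dg A B c =
     {(x, y, z).
        0 \<in> (\<lambda>v. v + Df x + A z) ` subdifferential p x \<and>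
        0 \<in> (\<lambda>v. v + Dg y + B z) ` subdifferential q y \<and>
        adjoint A x + adjoint B y = c}"

text \<open>\<open>u\<close> minimizes \<open>h + \<langle>\<cdot>, H\<cdot>\<rangle>/2 - \<langle>l, \<cdot>\<rangle>\<close> up to an error \<open>e\<close>, measured by a subgradient at \<open>u\<close>.\<close>

definition inexact_prox_step ::
  "('a::euclidean_space \<Rightarrow> ereal) \<Rightarrow> ('a \<Rightarrow> 'a) \<Rightarrow> 'a \<Rightarrow> real \<Rightarrow> 'a \<Rightarrow> bool" where
  "inexact_prox_step h H l e u \<longleftrightarrow>
     (\<exists>d \<in> subdifferential (\<lambda>v. h v + ereal (1/2 * (v \<bullet> H v) - l \<bullet> v)) u.
        norm (inv (op_sqrt H) d) \<le> e)"

text \<open>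
  \<open>Sf'\<close>, \<open>Sg'\<close> are the majorization operators \<open>\<Sigma>\<^sub>f\<close>-hat, \<open>\<Sigma>\<^sub>g\<close>-hat.
\<close>

definition imsPADMM ::
  "('x::euclidean_space \<Rightarrow> ereal) \<Rightarrow> ('y::euclidean_space \<Rightarrow> ereal) \<Rightarrow> ('x \<Rightarrow> 'x) \<Rightarrow> ('y \<Rightarrow> 'y) \<Rightarrow>
   ('z::euclidean_space \<Rightarrow> 'x) \<Rightarrow> ('z \<Rightarrow> 'y) \<Rightarrow> 'z \<Rightarrow>
   ('x \<Rightarrow> 'x) \<Rightarrow> ('y \<Rightarrow> 'y) \<Rightarrow> ('x \<Rightarrow> 'x) \<Rightarrow> ('y \<Rightarrow> 'y) \<Rightarrow> real \<Rightarrow> real \<Rightarrow> (nat \<Rightarrow> real) \<Rightarrow>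
   (nat \<Rightarrow> 'x) \<Rightarrow> (nat \<Rightarrow> 'y) \<Rightarrow> (nat \<Rightarrow> 'z) \<Rightarrow> bool" where
  "imsPADMM p q Df Dg A B c Sf' Sg' S T \<sigma> \<tau> \<epsilon> x y z \<longleftrightarrow>
     (let M = (\<lambda>u. Sf' u + S u + \<sigma> *\<^sub>R A (adjoint A u));
          N = (\<lambda>v. Sg' v + T v + \<sigma> *\<^sub>R B (adjoint B v))
      in x 0 \<in> effective_dom p \<and> y 0 \<in> effective_dom q \<and>
         (\<forall>k.
            inexact_prox_step p M
              (- (Df (x k) + A (z k) - M (x k)
                  + \<sigma> *\<^sub>R A (adjoint A (x k) + adjoint B (y k) - c)))
              (\<epsilon> k) (x (Suc k)) \<and>
            inexact_prox_step q N
              (- (Dg (y k) + B (z k) - N (y k)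
                  + \<sigma> *\<^sub>R B (adjoint A (x (Suc k)) + adjoint B (y k) - c)))
              (\<epsilon> k) (y (Suc k)) \<and>
            z (Suc k) = z k + (\<tau> * \<sigma>) *\<^sub>R (adjoint A (x (Suc k)) + adjoint B (y (Suc k)) - c)))"

definition imsPADMM_alpha :: "real \<Rightarrow> real" where
  "imsPADMM_alpha \<tau> = 1/2 * (1 + \<tau> / min (1 + \<tau>) (1 + 1 / \<tau>))"

end

theory Submission
  imports Defs
begin

text \<open>
  Fix a KKT point and measure the distance of the iterates to it in the metric of
  \<open>P = \<Sigma>\<^sub>f-hat + S\<close>, \<open>Q = \<Sigma>\<^sub>g-hat + T\<close>, \<open>\<sigma> B B\<^sup>*\<close> and \<open>1/(\<tau>\<sigma>)\<close>. Monotonicity of the subdifferentials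
  together with the majorization bounds makes this energy decrease, up to the cross term
  \<open>\<langle>B\<^sup>* (y\<^sup>k\<^sup>+\<^sup>1 - y\<^sup>k), r\<^sup>k\<^sup>+\<^sup>1\<rangle>\<close> with the residual \<open>r\<^sup>k = A\<^sup>* x\<^sup>k + B\<^sup>* y\<^sup>k - c\<close>. Comparing the inclusions of two
  consecutive \<open>y\<close>-steps turns it into \<open>(1 - \<tau>) \<langle>B\<^sup>* (y\<^sup>k\<^sup>+\<^sup>1 - y\<^sup>k), r\<^sup>k\<rangle>\<close>, which is absorbed because
  \<open>\<tau>\<^sup>2 < 1 + \<tau>\<close>. The inexactness contributes at most \<open>\<epsilon>\<^sub>k\<close> times the square root of the energy, so the
  energy converges and all differences of consecutive iterates vanish; for \<open>x\<close> one uses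
  \<open>A\<^sup>* (x\<^sup>k\<^sup>+\<^sup>1 - x\<^sup>k) = r\<^sup>k\<^sup>+\<^sup>1 - r\<^sup>k - B\<^sup>* (y\<^sup>k\<^sup>+\<^sup>1 - y\<^sup>k)\<close>. A cluster
  point is then a KKT point, and the energy relative to it has limit 0.
\<close>

section \<open>Self-adjoint operators\<close>

lemma psd_op_imp_self_adjoint: "psd_op H \<Longrightarrow> self_adjoint H"
  and pd_op_imp_self_adjoint: "pd_op H \<Longrightarrow> self_adjoint H"
  by (simp_all add: psd_op_def pd_op_def)

lemma self_adjoint_imp_linear: "self_adjoint H \<Longrightarrow> linear H"
  and self_adjoint_inner: "self_adjoint H \<Longrightarrow> H u \<bullet> v = u \<bullet> H v"
  by (simp_all add: self_adjoint_def)

lemma self_adjoint_inner_swap: "self_adjoint H \<Longrightarrow> v \<bullet> H u = u \<bullet> H v"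
  by (metis self_adjoint_inner inner_commute)

lemma pd_op_imp_psd_op: "pd_op H \<Longrightarrow> psd_op H"
  unfolding pd_op_def psd_op_def by (metis inner_zero_left less_eq_real_def)

lemma op_sqnorm_nonneg: "psd_op H \<Longrightarrow> 0 \<le> op_sqnorm H u"
  by (simp add: psd_op_def op_sqnorm_def)

lemma op_sqnorm_diff:
  assumes "self_adjoint H"
  shows "op_sqnorm H (u - v) = op_sqnorm H u - 2 * (u \<bullet> H v) + op_sqnorm H v"
  using self_adjoint_inner_swap[OF assms, of v u]
  by (simp add: op_sqnorm_def linear_diff[OF self_adjoint_imp_linear[OF assms]]
      inner_diff_left inner_diff_right)

lemma op_sqnorm_add:
  assumes "self_adjoint H"
  shows "op_sqnorm H (u + v) = op_sqnorm H u + 2 * (u \<bullet> H v) + op_sqnorm H v"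
  using self_adjoint_inner_swap[OF assms, of v u]
  by (simp add: op_sqnorm_def linear_add[OF self_adjoint_imp_linear[OF assms]]
      inner_add_left inner_add_right)

lemma op_sqnorm_minus: "self_adjoint H \<Longrightarrow> op_sqnorm H (- u) = op_sqnorm H u"
  by (simp add: op_sqnorm_def linear_neg[OF self_adjoint_imp_linear])

lemma op_sqnorm_minus_commute: "self_adjoint H \<Longrightarrow> op_sqnorm H (u - v) = op_sqnorm H (v - u)"
  using op_sqnorm_minus[of H "u - v"] by simp

text \<open>Parallelogram law, with the nonnegative form at \<open>u + v\<close> dropped.\<close>

lemma op_sqnorm_diff_le:
  assumes "psd_op H"
  shows "op_sqnorm H (u - v) \<le> 2 * op_sqnorm H u + 2 * op_sqnorm H v"
  using op_sqnorm_nonneg[OF assms, of "u + v"]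
  by (simp add: op_sqnorm_diff op_sqnorm_add psd_op_imp_self_adjoint[OF assms])

lemma self_adjoint_add: "self_adjoint H \<Longrightarrow> self_adjoint K \<Longrightarrow> self_adjoint (\<lambda>u. H u + K u)"
  by (auto simp: self_adjoint_def inner_left_distrib inner_right_distrib linear_compose_add)

lemma self_adjoint_scaleR: "self_adjoint H \<Longrightarrow> self_adjoint (\<lambda>u. t *\<^sub>R H u)"
  by (auto simp: self_adjoint_def linear_compose_scale_right)

lemma psd_op_add: "psd_op H \<Longrightarrow> psd_op K \<Longrightarrow> psd_op (\<lambda>u. H u + K u)"
  by (simp add: psd_op_def self_adjoint_add inner_right_distrib)

lemma self_adjoint_compose_adjoint:
  fixes A :: "'a::euclidean_space \<Rightarrow> 'b::euclidean_space"
  assumes "linear A"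
  shows "self_adjoint (\<lambda>u. A (adjoint A u))"
  unfolding self_adjoint_def
proof (intro conjI allI)
  show "linear (\<lambda>u. A (adjoint A u))"
    using linear_compose[OF adjoint_linear[OF assms] assms] by (simp add: o_def)
  show "A (adjoint A u) \<bullet> v = u \<bullet> A (adjoint A v)" for u v
    using adjoint_works[OF assms, of "adjoint A u" v] adjoint_works[OF assms, of "adjoint A v" u]
    by (simp add: inner_commute)
qed

lemma inner_compose_adjoint:
  fixes A :: "'a::euclidean_space \<Rightarrow> 'b::euclidean_space"
  assumes "linear A"
  shows "u \<bullet> A (adjoint A u) = (norm (adjoint A u))\<^sup>2"
  using adjoint_works[OF assms, of "adjoint A u" u]
  by (simp add: inner_commute power2_norm_eq_inner)

text \<open>By compactness the form attains its minimum on the unit sphere. The minimum is positive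
  and serves as \<open>\<mu>\<close>; homogeneity extends the bound to all vectors.\<close>

lemma pd_op_lower_bound:
  fixes H :: "'a::euclidean_space \<Rightarrow> 'a"
  assumes "pd_op H"
  obtains \<mu> where "0 < \<mu>" "\<And>u. \<mu> * (norm u)\<^sup>2 \<le> op_sqnorm H u"
proof -
  have lin: "linear H"
    using assms by (simp add: pd_op_def self_adjoint_def)
  have "continuous_on (sphere 0 1) (op_sqnorm H)"
    unfolding op_sqnorm_def
    by (intro continuous_intros linear_continuous_on linear_conv_bounded_linear[THEN iffD1] lin)
  moreover have "sphere (0::'a) 1 \<noteq> {}"
    by simp
  ultimately obtain w where w: "w \<in> sphere 0 1" "\<And>u. u \<in> sphere 0 1 \<Longrightarrow> op_sqnorm H w \<le> op_sqnorm H u"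
    using continuous_attains_inf[of "sphere 0 1" "op_sqnorm H"] by auto
  have "op_sqnorm H w * (norm u)\<^sup>2 \<le> op_sqnorm H u" for u
  proof (cases "u = 0")
    case True
    then show ?thesis
      by (simp add: op_sqnorm_def)
  next
    case False
    then have "op_sqnorm H w * (norm u)\<^sup>2 \<le> op_sqnorm H (inverse (norm u) *\<^sub>R u) * (norm u)\<^sup>2"
      by (intro mult_right_mono w) auto
    also have "\<dots> = op_sqnorm H u"
      using False by (simp add: op_sqnorm_def linear_scale[OF lin] field_simps power2_eq_square)
    finally show ?thesis .
  qed
  moreover have "0 < op_sqnorm H w"
    using assms w(1) unfolding pd_op_def op_sqnorm_def by (metis mem_sphere_0 norm_zero zero_neq_one)
  ultimately show ?thesis
    using that by blast
qed

section \<open>Spectral theorem and square roots of positive semidefinite operators\<close>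

text \<open>Along the line \<open>w + t *\<^sub>R v\<close> the quadratic coefficient vanishes, so
  the form is affine in \<open>t\<close>; with a nonzero slope it would become negative. The version
  relative to \<open>V\<close> is what the eigenvector recursion needs, where nonnegativity is known
  on \<open>V\<close> only.\<close>

lemma psd_form_null:
  fixes K :: "'a::euclidean_space \<Rightarrow> 'a"
  assumes K: "self_adjoint K" and V: "subspace V" and nonneg: "\<And>u. u \<in> V \<Longrightarrow> 0 \<le> u \<bullet> K u"
    and v: "v \<in> V" "v \<bullet> K v = 0" and w: "w \<in> V"
  shows "w \<bullet> K v = 0"
proof (rule ccontr)
  assume ne: "w \<bullet> K v \<noteq> 0"
  \<comment> \<open>Chosen so that the affine function takes the value -1.\<close>
  define t where "t = - (w \<bullet> K w + 1) / (2 * (w \<bullet> K v))"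
  have "0 \<le> (w + t *\<^sub>R v) \<bullet> K (w + t *\<^sub>R v)"
    using V v w by (intro nonneg subspace_add subspace_scale)
  also have "\<dots> = w \<bullet> K w + 2 * t * (w \<bullet> K v)"
    using self_adjoint_inner_swap[OF K, of v w] v(2)
    by (simp add: linear_add[OF self_adjoint_imp_linear[OF K]]
        linear_scale[OF self_adjoint_imp_linear[OF K]] inner_add_left inner_add_right)
  also have "\<dots> = - 1"
    using ne by (simp add: t_def field_simps)
  finally show False
    by simp
qed

text \<open>A maximizer of the Rayleigh quotient on \<open>V\<close> is an eigenvector; recurse on its orthogonal complement.\<close>

lemma self_adjoint_eigenbasis_subspace:
  fixes H :: "'a::euclidean_space \<Rightarrow> 'a"
  assumes H: "self_adjoint H"
  shows "subspace V \<Longrightarrow> H ` V \<subseteq> V \<Longrightarrow>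
    \<exists>E. finite E \<and> pairwise orthogonal E \<and> (\<forall>b\<in>E. norm b = 1 \<and> (\<exists>l. H b = l *\<^sub>R b)) \<and> span E = V"
proof (induction "dim V" arbitrary: V rule: less_induct)
  case less
  note lin = self_adjoint_imp_linear[OF H]
  show ?case
  proof (cases "V = {0}")
    case True
    then show ?thesis
      by (intro exI[of _ "{}"]) simp
  next
    case False
    have "0 \<in> V"
      using less.prems(1) by (rule subspace_0)
    with False obtain a where a: "a \<in> V" "a \<noteq> 0"
      by blast
    have "inverse (norm a) *\<^sub>R a \<in> V \<inter> sphere 0 1"
      using a less.prems(1) by (auto intro: subspace_scale)
    then have "V \<inter> sphere 0 1 \<noteq> {}"
      by blast
    moreover have "continuous_on (V \<inter> sphere 0 1) (op_sqnorm H)"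
      unfolding op_sqnorm_def
      by (intro continuous_intros linear_continuous_on linear_conv_bounded_linear[THEN iffD1] lin)
    moreover have "compact (V \<inter> sphere 0 1)"
      using closed_subspace[OF less.prems(1)] by (simp add: closed_Int_compact)
    ultimately have "\<exists>v\<in>V \<inter> sphere 0 1. \<forall>u\<in>V \<inter> sphere 0 1. op_sqnorm H u \<le> op_sqnorm H v"
      by (intro continuous_attains_sup)
    then obtain v where "v \<in> V \<inter> sphere 0 1" "\<forall>u\<in>V \<inter> sphere 0 1. op_sqnorm H u \<le> op_sqnorm H v"
      by blast
    then have v: "v \<in> V" "norm v = 1"
      and max: "u \<in> V \<Longrightarrow> norm u = 1 \<Longrightarrow> op_sqnorm H u \<le> op_sqnorm H v" for u
      by auto
    define l where "l = op_sqnorm H v"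
    \<comment> \<open>The form of this shifted operator is nonnegative on \<open>V\<close>, since
      \<open>v\<close> maximizes the Rayleigh quotient there, and it vanishes at \<open>v\<close>.
      Hence \<open>K v = 0\<close>, which is the eigenvector equation.\<close>
    define K where "K u = l *\<^sub>R u + (-1) *\<^sub>R H u" for u
    have K: "self_adjoint K"
      unfolding K_def by (intro self_adjoint_add self_adjoint_scaleR H) (auto simp: self_adjoint_def linear_id[unfolded id_def])
    have nonneg: "0 \<le> u \<bullet> K u" if "u \<in> V" for u
    proof (cases "u = 0")
      case False
      have "op_sqnorm H (inverse (norm u) *\<^sub>R u) \<le> l"
        unfolding l_def using False that less.prems(1) by (intro max) (auto intro: subspace_scale)
      then have "u \<bullet> H u \<le> l * (norm u)\<^sup>2"
        using False by (simp add: op_sqnorm_def linear_scale[OF lin] field_simps power2_eq_square)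
      then show ?thesis
        by (simp add: K_def inner_diff_right flip: power2_norm_eq_inner)
    qed simp
    have "v \<bullet> K v = 0"
      using v by (simp add: K_def l_def op_sqnorm_def inner_diff_right flip: power2_norm_eq_inner)
    moreover have "K v \<in> V"
      using less.prems v by (auto simp: K_def intro!: subspace_diff subspace_scale)
    ultimately have "K v \<bullet> K v = 0"
      using psd_form_null[OF K less.prems(1) nonneg] v by blast
    then have eig: "H v = l *\<^sub>R v"
      by (simp add: K_def)
    define W where "W = V \<inter> {u. orthogonal v u}"
    have W: "subspace W"
      unfolding W_def using less.prems(1) subspace_orthogonal_to_vector[of v]
      by (rule subspace_inter)
    have HW: "H ` W \<subseteq> W"
    proof
      fix u' assume "u' \<in> H ` W"
      then obtain u where u: "u \<in> V" "v \<bullet> u = 0" "u' = H u"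
        by (auto simp: W_def orthogonal_def)
      have "v \<bullet> H u = 0"
        using self_adjoint_inner[OF H, of v u] u by (simp add: eig)
      then show "u' \<in> W"
        using u less.prems(2) by (auto simp: W_def orthogonal_def)
    qed
    have "v \<notin> W"
      using v by (auto simp: W_def orthogonal_def)
    then have "W \<subset> V"
      using v by (auto simp: W_def)
    then have "dim W < dim V"
      using W less.prems(1) by (intro dim_psubset) (metis span_eq_iff)
    from less.hyps[OF this W HW] obtain E where E: "finite E" "pairwise orthogonal E"
      "\<forall>b\<in>E. norm b = 1 \<and> (\<exists>l. H b = l *\<^sub>R b)" "span E = W"
      by blast
    have EW: "b \<in> W" if "b \<in> E" for b
      using E(4) that by (auto intro: span_base)
    have "span (insert v E) = V"
    proof
      show "span (insert v E) \<subseteq> V"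
        using EW v less.prems(1) by (intro span_minimal) (auto simp: W_def)
      show "V \<subseteq> span (insert v E)"
      proof
        fix u assume u: "u \<in> V"
        have "u - (v \<bullet> u) *\<^sub>R v \<in> W"
          using u v less.prems(1)
          by (auto simp: W_def orthogonal_def inner_diff_right subspace_diff subspace_scale
              simp flip: power2_norm_eq_inner)
        then show "u \<in> span (insert v E)"
          unfolding span_insert E(4) by blast
      qed
    qed
    moreover have "pairwise orthogonal (insert v E)"
      using E(2) EW by (auto simp: pairwise_insert W_def orthogonal_commute)
    ultimately show ?thesis
      using E(1,3) v eig by (intro exI[of _ "insert v E"]) auto
  qed
qed

lemma self_adjoint_eigenbasis:
  fixes H :: "'a::euclidean_space \<Rightarrow> 'a"
  assumes "self_adjoint H"
  obtains E where "finite E" "pairwise orthogonal E" "\<And>b. b \<in> E \<Longrightarrow> norm b = 1"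
    "\<And>b. b \<in> E \<Longrightarrow> H b = op_sqnorm H b *\<^sub>R b" "span E = UNIV"
proof -
  obtain E where E: "finite E" "pairwise orthogonal E"
    "\<forall>b\<in>E. norm b = 1 \<and> (\<exists>l. H b = l *\<^sub>R b)" "span E = UNIV"
    using self_adjoint_eigenbasis_subspace[OF assms, of UNIV] by auto
  have "H b = op_sqnorm H b *\<^sub>R b" if "b \<in> E" for b
    using E(3) that by (force simp: op_sqnorm_def simp flip: power2_norm_eq_inner)
  with E show ?thesis
    using that by blast
qed

text \<open>Each vector of an orthonormal eigenbasis is scaled by the square root of its eigenvalue;
  for a unit eigenvector \<open>b\<close> that eigenvalue is \<open>op_sqnorm H b\<close>.\<close>

lemma ex_psd_sqrt:
  fixes H :: "'a::euclidean_space \<Rightarrow> 'a"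
  assumes H: "psd_op H"
  shows "\<exists>R. psd_op R \<and> R \<circ> R = H"
proof -
  obtain E where E: "finite E" "pairwise orthogonal E" "\<And>b. b \<in> E \<Longrightarrow> norm b = 1"
    "\<And>b. b \<in> E \<Longrightarrow> H b = op_sqnorm H b *\<^sub>R b" "span E = UNIV"
    using self_adjoint_eigenbasis[OF psd_op_imp_self_adjoint[OF H]] by metis
  define R where "R u = (\<Sum>b\<in>E. (sqrt (op_sqnorm H b) * (u \<bullet> b)) *\<^sub>R b)" for u
  have lin: "linear R"
    by (auto simp: linear_iff R_def algebra_simps sum.distrib scaleR_right.sum)
  have "self_adjoint R"
    unfolding self_adjoint_def
    using lin by (auto simp: R_def inner_sum_left inner_sum_right inner_commute algebra_simps)
  moreover have "0 \<le> u \<bullet> R u" for u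
    using op_sqnorm_nonneg[OF H]
    by (auto simp: R_def inner_sum_right mult.assoc intro!: sum_nonneg mult_nonneg_nonneg[of "sqrt _"])
  ultimately have psd: "psd_op R"
    by (simp add: psd_op_def)
  have R: "R b = sqrt (op_sqnorm H b) *\<^sub>R b" if "b \<in> E" for b
  proof -
    have "R b = (\<Sum>b'\<in>E. if b' = b then sqrt (op_sqnorm H b) *\<^sub>R b else 0)"
      unfolding R_def
    proof (rule sum.cong)
      fix b' assume "b' \<in> E"
      then show "(sqrt (op_sqnorm H b') * (b \<bullet> b')) *\<^sub>R b' = (if b' = b then sqrt (op_sqnorm H b) *\<^sub>R b else 0)"
        using E(2,3) that by (auto simp: pairwise_def orthogonal_def simp flip: power2_norm_eq_inner)
    qed simp
    then show ?thesis
      using E(1) that by simp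
  qed
  have "(R \<circ> R) u = H u" for u
  proof (rule linear_eq_on_span[where B = E and f = "R \<circ> R" and g = H])
    show "linear (R \<circ> R)"
      using lin lin by (rule linear_compose)
    show "linear H"
      using H by (intro self_adjoint_imp_linear psd_op_imp_self_adjoint)
    show "(R \<circ> R) b = H b" if "b \<in> E" for b
      using E(4)[OF that] op_sqnorm_nonneg[OF H, of b]
      by (simp add: R[OF that] linear_scale[OF lin])
    show "u \<in> span E"
      using E(5) by simp
  qed
  then show ?thesis
    using psd by blast
qed

text \<open>If \<open>b\<close> is an eigenvector of \<open>R'\<close> with eigenvalue
  \<open>t\<close>, then \<open>v = R b - t *\<^sub>R b\<close> satisfies
  \<open>R v = - t *\<^sub>R v\<close>. A positive semidefinite \<open>R\<close> has no negative
  eigenvalue, so \<open>v = 0\<close>. Thus both roots agree on a basis of eigenvectors of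
  \<open>R'\<close>. Uniqueness is what gives the definite description in \<open>op_sqrt\<close> a
  meaning.\<close>

lemma psd_sqrt_unique:
  fixes R R' :: "'a::euclidean_space \<Rightarrow> 'a"
  assumes R: "psd_op R" and R': "psd_op R'" and eq: "R \<circ> R = R' \<circ> R'"
  shows "R = R'"
proof
  fix u
  note lin = self_adjoint_imp_linear[OF psd_op_imp_self_adjoint]
  obtain E where E: "\<And>b. b \<in> E \<Longrightarrow> R' b = op_sqnorm R' b *\<^sub>R b" "span E = UNIV"
    using self_adjoint_eigenbasis[OF psd_op_imp_self_adjoint[OF R']] by metis
  show "R u = R' u"
  proof (rule linear_eq_on_span[where B = E and f = R and g = R'])
    fix b assume b: "b \<in> E"
    define t where "t = op_sqnorm R' b"
    define v where "v = R b - t *\<^sub>R b"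
    have "0 \<le> t"
      unfolding t_def using R' by (rule op_sqnorm_nonneg)
    have R'b: "R' b = t *\<^sub>R b"
      unfolding t_def using b by (rule E)
    have "R (R b) = t\<^sup>2 *\<^sub>R b"
      using fun_cong[OF eq, of b] R'b by (simp add: linear_scale[OF lin[OF R']] power2_eq_square)
    then have v: "R v = - t *\<^sub>R v"
      by (simp add: v_def linear_diff[OF lin[OF R]] linear_scale[OF lin[OF R]] algebra_simps power2_eq_square)
    have "v = 0"
    \<comment> \<open>For \<open>t = 0\<close> the sign argument is void; instead
      \<open>R (R b) = 0\<close> and self-adjointness give \<open>R b = 0\<close>.\<close>
    proof (cases "t = 0")
      case True
      have "R b \<bullet> R b = b \<bullet> R (R b)"
        using self_adjoint_inner[OF psd_op_imp_self_adjoint[OF R]] by simp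
      then show ?thesis
        using \<open>R (R b) = t\<^sup>2 *\<^sub>R b\<close> True by (simp add: v_def)
    next
      case False
      have "0 \<le> v \<bullet> R v"
        using R by (simp add: psd_op_def)
      then show ?thesis
        using False \<open>0 \<le> t\<close> v by (simp add: mult_le_0_iff flip: power2_norm_eq_inner)
    qed
    then show "R b = R' b"
      by (simp add: v_def R'b)
  qed (use E R R' lin in auto)
qed

lemma op_sqrt:
  fixes H :: "'a::euclidean_space \<Rightarrow> 'a"
  assumes "psd_op H"
  shows "psd_op (op_sqrt H)" and "op_sqrt H \<circ> op_sqrt H = H"
proof -
  have "\<exists>!R. psd_op R \<and> R \<circ> R = H"
    using ex_psd_sqrt[OF assms] by (auto intro: psd_sqrt_unique)
  from theI'[OF this] show "psd_op (op_sqrt H)" and "op_sqrt H \<circ> op_sqrt H = H"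
    unfolding op_sqrt_def by blast+
qed

text \<open>Translates the accuracy criterion of the algorithm into plain norms: \<open>d\<close> is
  the image of \<open>inv (op_sqrt H) d\<close> under the bounded map \<open>op_sqrt H\<close>. That
  \<open>inv\<close> yields a true preimage needs surjectivity, which in finite dimension follows
  from injectivity, inherited from \<open>H\<close>.\<close>

lemma norm_le_inv_op_sqrt:
  fixes H :: "'a::euclidean_space \<Rightarrow> 'a"
  assumes H: "pd_op H"
  obtains C where "0 \<le> C" "\<And>d. norm d \<le> C * norm (inv (op_sqrt H) d)"
proof -
  let ?R = "op_sqrt H"
  note R = op_sqrt[OF pd_op_imp_psd_op[OF H]]
  have lin: "linear ?R"
    using R(1) by (intro self_adjoint_imp_linear psd_op_imp_self_adjoint)
  have "u = 0" if "H u = 0" for u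
    using H that by (force simp: pd_op_def)
  then have "inj H"
    using self_adjoint_imp_linear[OF pd_op_imp_self_adjoint[OF H]] by (simp add: linear_inj_iff_eq_0)
  then have "inj ?R"
    using R(2) inj_on_imageI2[of ?R ?R UNIV] by simp
  then have "surj ?R"
    using linear_injective_imp_surjective[OF lin] by simp
  obtain C where C: "\<And>u. norm (?R u) \<le> C * norm u" "0 < C"
    using linear_bounded_pos[OF lin] by blast
  have "norm d \<le> C * norm (inv ?R d)" for d
    using C(1)[of "inv ?R d"] \<open>surj ?R\<close> by (simp add: surj_f_inv_f)
  then show ?thesis
    using C(2) that[of C] by simp
qed

section \<open>Closed proper convex functions and their subdifferentials\<close>

lemma block_component_eq:
  assumes "block_product m X" and "\<And>j. j \<in> {1..m} \<Longrightarrow> v j \<in> X j" and "i \<in> {1..m}"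
    and "u = (\<Sum>j=1..m. v j)"
  shows "block_component m X i u = v i"
  using assms block_component_sum by blast

lemma block_component_mem:
  assumes "block_product m X" and "i \<in> {1..m}"
  shows "block_component m X i u \<in> X i"
  using ex_block_sum[OF assms(1), of u] block_component_sum[OF assms(1) _ assms(2)] assms(2) by metis

lemma linear_block_component:
  assumes X: "block_product m X" and i: "i \<in> {1..m}"
  shows "linear (block_component m X i)"
proof (rule linearI)
  have sub: "subspace (X j)" if "j \<in> {1..m}" for j
    using X that by (simp add: block_product_def)
  show "block_component m X i (u + v) = block_component m X i u + block_component m X i v" for u v
  proof -
    obtain a b where a: "\<forall>j\<in>{1..m}. a j \<in> X j" "u = (\<Sum>j=1..m. a j)"
      and b: "\<forall>j\<in>{1..m}. b j \<in> X j" "v = (\<Sum>j=1..m. b j)"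
      using ex_block_sum[OF X] by metis
    have "block_component m X i (u + v) = a i + b i"
      using a b sub i by (intro block_component_eq[OF X, of "\<lambda>j. a j + b j"])
        (auto simp: sum.distrib subspace_add)
    moreover have "block_component m X i u = a i" "block_component m X i v = b i"
      using block_component_eq[OF X _ i a(2)] block_component_eq[OF X _ i b(2)] a(1) b(1) by blast+
    ultimately show ?thesis
      by simp
  qed
  show "block_component m X i (t *\<^sub>R u) = t *\<^sub>R block_component m X i u" for t u
  proof -
    obtain a where a: "\<forall>j\<in>{1..m}. a j \<in> X j" "u = (\<Sum>j=1..m. a j)"
      using ex_block_sum[OF X] by metis
    have "block_component m X i (t *\<^sub>R u) = t *\<^sub>R a i"
      using a sub i by (intro block_component_eq[OF X, of "\<lambda>j. t *\<^sub>R a j"])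
        (auto simp: scaleR_right.sum subspace_scale)
    moreover have "block_component m X i u = a i"
      using block_component_eq[OF X _ i a(2)] a(1) by blast
    ultimately show ?thesis
      by simp
  qed
qed

lemma block_component_ident:
  assumes X: "block_product m X" and i: "i \<in> {1..m}" and u: "u \<in> X i"
  shows "block_component m X i u = u"
proof -
  have "block_component m X i u = (\<lambda>j. if j = i then u else 0) i"
  proof (rule block_component_eq[where v = "\<lambda>j. if j = i then u else 0", OF X _ i])
    show "(if j = i then u else 0) \<in> X j" if "j \<in> {1..m}" for j
      using X that u by (simp add: block_product_def subspace_0)
    show "u = (\<Sum>j=1..m. if j = i then u else 0)"
      using i by simp
  qed
  then show ?thesis
    by simp
qed

text \<open>The epigraph of the composed function is the preimage of the epigraph of
  \<open>h\<close> under a continuous linear map, so it stays convex and closed. A point with finite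
  value survives because the projection fixes the first block.\<close>

lemma closed_proper_convex_on_block_component:
  assumes X: "block_product m X" and h: "closed_proper_convex_on (X 1) h"
  shows "closed_proper_convex_on UNIV (\<lambda>u. h (block_component m X 1 u))"
proof -
  let ?L = "block_component m X 1"
  have 1: "1 \<in> {1..m}"
    using X by (simp add: block_product_def)
  note lin = linear_block_component[OF X 1] and mem = block_component_mem[OF X 1]
  define L where "L = (\<lambda>(u, r::real). (?L u, r))"
  have "linear L"
    using linear_add[OF lin] linear_scale[OF lin] by (auto simp: L_def linear_iff)
  have epi: "epigraph_on UNIV (\<lambda>u. h (?L u)) = L -` epigraph_on (X 1) h"
    using mem by (auto simp: epigraph_on_def L_def)
  have "\<exists>u. h (?L u) \<noteq> \<infinity>"
    using h block_component_ident[OF X 1] unfolding closed_proper_convex_on_def by metis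
  moreover have "convex (epigraph_on UNIV (\<lambda>u. h (?L u)))"
    unfolding epi using h \<open>linear L\<close>
    by (intro convex_linear_vimage) (simp_all add: closed_proper_convex_on_def)
  moreover have "closed (epigraph_on UNIV (\<lambda>u. h (?L u)))"
    unfolding epi using h \<open>linear L\<close>
    by (intro closed_vimage linear_continuous_on linear_conv_bounded_linear[THEN iffD1])
      (simp_all add: closed_proper_convex_on_def)
  ultimately show ?thesis
    using h mem by (auto simp: closed_proper_convex_on_def)
qed

section \<open>Subgradients of closed proper convex functions\<close>

text \<open>An infinite value at \<open>u\<close> would, by the subgradient inequality, force
  infinite values everywhere, against properness.\<close>

lemma subdifferential_finite:
  assumes h: "closed_proper_convex_on UNIV h" and v: "v \<in> subdifferential h u"
  obtains r where "h u = ereal r"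
proof -
  obtain u0 where "h u0 \<noteq> \<infinity>"
    using h by (auto simp: closed_proper_convex_on_def)
  moreover have "h u + ereal (v \<bullet> (u0 - u)) \<le> h u0"
    using v by (simp add: subdifferential_def)
  moreover have "h u \<noteq> -\<infinity>"
    using h by (simp add: closed_proper_convex_on_def)
  ultimately show ?thesis
    using that by (cases "h u") auto
qed

lemma subdifferential_monotone:
  assumes h: "closed_proper_convex_on UNIV h"
    and v: "v \<in> subdifferential h u" and v': "v' \<in> subdifferential h u'"
  shows "0 \<le> (v - v') \<bullet> (u - u')"
proof -
  obtain r r' where r: "h u = ereal r" "h u' = ereal r'"
    using subdifferential_finite[OF h v] subdifferential_finite[OF h v'] by metis
  have "h u + ereal (v \<bullet> (u' - u)) \<le> h u'" "h u' + ereal (v' \<bullet> (u - u')) \<le> h u"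
    using v v' by (simp_all add: subdifferential_def)
  then show ?thesis
    by (simp add: r inner_diff_left inner_diff_right)
qed

text \<open>For fixed \<open>w\<close> with finite \<open>h w\<close>, the subgradient inequality at
  \<open>u k\<close> says that the point \<open>(u k, h w - v k \<bullet> (w - u k))\<close> lies in
  the epigraph. Closedness of the epigraph then passes it to the limit.\<close>

lemma subdifferential_closed_graph:
  assumes h: "closed_proper_convex_on UNIV h"
    and v: "\<And>k. v k \<in> subdifferential h (u k)"
    and u_lim: "u \<longlonglongrightarrow> u'" and v_lim: "v \<longlonglongrightarrow> v'"
  shows "v' \<in> subdifferential h u'"
  unfolding subdifferential_def
proof (intro CollectI allI)
  fix w
  show "h u' + ereal (v' \<bullet> (w - u')) \<le> h w"
  proof (cases "h w")
    case (real r)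
    have mem: "(u k, r - v k \<bullet> (w - u k)) \<in> epigraph_on UNIV h" for k
    proof -
      obtain s where "h (u k) = ereal s"
        using subdifferential_finite[OF h v] .
      moreover have "h (u k) + ereal (v k \<bullet> (w - u k)) \<le> h w"
        using v[of k] by (simp add: subdifferential_def)
      ultimately show ?thesis
        by (simp add: epigraph_on_def real)
    qed
    have lim: "(\<lambda>k. (u k, r - v k \<bullet> (w - u k))) \<longlonglongrightarrow> (u', r - v' \<bullet> (w - u'))"
      by (intro tendsto_intros u_lim v_lim)
    have "(u', r - v' \<bullet> (w - u')) \<in> epigraph_on UNIV h"
      by (rule closed_sequentially[OF _ mem lim]) (use h in \<open>simp add: closed_proper_convex_on_def\<close>)
    moreover have "h u' \<noteq> -\<infinity>"
      using h by (simp add: closed_proper_convex_on_def)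
    ultimately show ?thesis
      by (cases "h u'") (auto simp: epigraph_on_def real)
  qed (use h in \<open>auto simp: closed_proper_convex_on_def\<close>)
qed

text \<open>
  The subgradient inequality at \<open>u + t (w - u)\<close> carries a quadratic error of order \<open>t\<^sup>2\<close>,
  which convexity turns into an error of order \<open>t\<close> at \<open>w\<close>.
\<close>

lemma subdifferential_quadratic_perturbation:
  assumes h: "closed_proper_convex_on UNIV h" and H: "self_adjoint H"
    and d: "d \<in> subdifferential (\<lambda>v. h v + ereal (1/2 * (v \<bullet> H v) - l \<bullet> v)) u"
  shows "d - H u + l \<in> subdifferential h u"
proof -
  let ?\<phi> = "\<lambda>v. 1/2 * (v \<bullet> H v) - l \<bullet> v"
  have lin: "linear H"
    using H by (simp add: self_adjoint_def)
  have sub: "h u + ereal (?\<phi> u) + ereal (d \<bullet> (w - u)) \<le> h w + ereal (?\<phi> w)" for w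
    using d by (simp add: subdifferential_def)
  have proper: "h w \<noteq> -\<infinity>" for w
    using h by (simp add: closed_proper_convex_on_def)
  obtain u0 where u0: "h u0 \<noteq> \<infinity>"
    using h by (auto simp: closed_proper_convex_on_def)
  obtain r where r: "h u = ereal r"
    using sub[of u0] u0 proper[of u] by (cases "h u"; cases "h u0") auto
  have "h u + ereal ((d - H u + l) \<bullet> (w - u)) \<le> h w" for w
  proof (cases "h w")
    case (real s)
    define e where "e = w - u"
    have key: "r + d \<bullet> e \<le> s + (H u \<bullet> e - l \<bullet> e) + t * (1/2 * (e \<bullet> H e))" if t: "0 < t" "t \<le> 1" for t
    proof -
      have "(1 - t) *\<^sub>R (u, r) + t *\<^sub>R (w, s) \<in> epigraph_on UNIV h"
        using h t unfolding closed_proper_convex_on_def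
        by (intro convexD_alt) (auto simp: epigraph_on_def r real)
      moreover have "(1 - t) *\<^sub>R (u, r) + t *\<^sub>R (w, s) = (u + t *\<^sub>R e, (1 - t) * r + t * s)"
        by (simp add: e_def algebra_simps)
      ultimately have le: "h (u + t *\<^sub>R e) \<le> ereal ((1 - t) * r + t * s)"
        by (simp add: epigraph_on_def)
      then obtain r' where r': "h (u + t *\<^sub>R e) = ereal r'" "r' \<le> (1 - t) * r + t * s"
        using proper[of "u + t *\<^sub>R e"] by (cases "h (u + t *\<^sub>R e)") auto
      have "r + ?\<phi> u + t * (d \<bullet> e) \<le> r' + ?\<phi> (u + t *\<^sub>R e)"
        using sub[of "u + t *\<^sub>R e"] by (simp add: r r')
      also have "?\<phi> (u + t *\<^sub>R e) = ?\<phi> u + t * (H u \<bullet> e - l \<bullet> e) + t * (t * (1/2 * (e \<bullet> H e)))"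
      proof -
        have "u \<bullet> H e = H u \<bullet> e" "e \<bullet> H u = H u \<bullet> e"
          using H by (simp_all add: self_adjoint_def inner_commute)
        then show ?thesis
          by (simp add: linear_add[OF lin] linear_scale[OF lin] algebra_simps)
      qed
      finally have "t * (r + d \<bullet> e) \<le> t * (s + (H u \<bullet> e - l \<bullet> e) + t * (1/2 * (e \<bullet> H e)))"
        using r'(2) by (simp add: algebra_simps)
      then show ?thesis
        using t by simp
    qed
    have "((\<lambda>t. s + (H u \<bullet> e - l \<bullet> e) + t * (1/2 * (e \<bullet> H e))) \<longlongrightarrow>
        s + (H u \<bullet> e - l \<bullet> e) + 0 * (1/2 * (e \<bullet> H e))) (at_right 0)"
      by (intro tendsto_intros)
    moreover have "\<forall>\<^sub>F t in at_right (0::real). r + d \<bullet> e \<le> s + (H u \<bullet> e - l \<bullet> e) + t * (1/2 * (e \<bullet> H e))"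
      using key by (auto simp: eventually_at_right_field intro!: exI[of _ 1])
    ultimately have "r + d \<bullet> e \<le> s + (H u \<bullet> e - l \<bullet> e) + 0 * (1/2 * (e \<bullet> H e))"
      by (intro tendsto_lowerbound) auto
    then show ?thesis
      by (simp add: r real e_def inner_diff_left inner_add_left)
  qed (use proper in auto)
  then show ?thesis
    by (simp add: subdifferential_def)
qed

section \<open>One inexact proximal gradient step\<close>

text \<open>Monotonicity is tested between the step and the reference point \<open>w\<close>, and
  the inner product with \<open>P (u\<^sub>1 - u\<^sub>0)\<close> becomes a difference of squares.
  The gradient terms are handled by the lower bound at \<open>(u\<^sub>1, w)\<close> and
  \<open>(w, u\<^sub>0)\<close> and the upper bound at \<open>(u\<^sub>1, u\<^sub>0)\<close>. The
  majorant \<open>H'\<close> in the latter cancels against its copy inside \<open>P\<close>, so only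
  \<open>S\<close> remains.\<close>

lemma prox_gradient_step:
  fixes h :: "'a::euclidean_space \<Rightarrow> ereal"
  assumes h: "closed_proper_convex_on UNIV h"
    and H: "psd_op H" and H': "self_adjoint H'" and S: "self_adjoint S"
    and lower: "\<And>u v. 1/2 * op_sqnorm H (u - v) \<le> f u - f v - Df v \<bullet> (u - v)"
    and upper: "\<And>u v. f u - f v - Df v \<bullet> (u - v) \<le> 1/2 * op_sqnorm H' (u - v)"
    and P: "P = (\<lambda>u. H' u + S u)"
    and step: "d - Df u\<^sub>0 - a - P (u\<^sub>1 - u\<^sub>0) \<in> subdifferential h u\<^sub>1"
    and opt: "- Df w - a' \<in> subdifferential h w"
  shows "(a - a') \<bullet> (u\<^sub>1 - w) + op_sqnorm P (u\<^sub>1 - w) / 2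
      + op_sqnorm S (u\<^sub>1 - u\<^sub>0) / 2 + op_sqnorm H (u\<^sub>1 - u\<^sub>0) / 4
    \<le> d \<bullet> (u\<^sub>1 - w) + op_sqnorm P (u\<^sub>0 - w) / 2"
proof -
  have "0 \<le> ((d - Df u\<^sub>0 - a - P (u\<^sub>1 - u\<^sub>0)) - (- Df w - a')) \<bullet> (u\<^sub>1 - w)"
    using h step opt by (rule subdifferential_monotone)
  then have mono: "(a - a') \<bullet> (u\<^sub>1 - w) + (u\<^sub>1 - w) \<bullet> P (u\<^sub>1 - u\<^sub>0)
      + Df u\<^sub>0 \<bullet> (u\<^sub>1 - w) - Df w \<bullet> (u\<^sub>1 - w) \<le> d \<bullet> (u\<^sub>1 - w)"
    unfolding inner_commute[of "u\<^sub>1 - w" "P (u\<^sub>1 - u\<^sub>0)"] by (simp add: inner_diff_left inner_add_left)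
  have "op_sqnorm P ((u\<^sub>1 - w) - (u\<^sub>1 - u\<^sub>0))
      = op_sqnorm P (u\<^sub>1 - w) - 2 * ((u\<^sub>1 - w) \<bullet> P (u\<^sub>1 - u\<^sub>0)) + op_sqnorm P (u\<^sub>1 - u\<^sub>0)"
    unfolding P using H' S by (intro op_sqnorm_diff self_adjoint_add)
  then have expand: "op_sqnorm P (u\<^sub>0 - w)
      = op_sqnorm P (u\<^sub>1 - w) - 2 * ((u\<^sub>1 - w) \<bullet> P (u\<^sub>1 - u\<^sub>0)) + op_sqnorm P (u\<^sub>1 - u\<^sub>0)"
    by simp
  have split: "op_sqnorm P (u\<^sub>1 - u\<^sub>0) = op_sqnorm H' (u\<^sub>1 - u\<^sub>0) + op_sqnorm S (u\<^sub>1 - u\<^sub>0)"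
    by (simp add: P op_sqnorm_def inner_add_right)
  have grad: "Df u\<^sub>0 \<bullet> (u\<^sub>1 - w) = Df u\<^sub>0 \<bullet> (u\<^sub>1 - u\<^sub>0) - Df u\<^sub>0 \<bullet> (w - u\<^sub>0)"
    by (simp add: inner_diff_right)
  \<comment> \<open>Origin of the factor 1/4: the two gains from the lower bounds, each with factor
    1/2, are merged into one term in the actual step.\<close>
  have "op_sqnorm H ((u\<^sub>1 - w) - (u\<^sub>0 - w)) \<le> 2 * op_sqnorm H (u\<^sub>1 - w) + 2 * op_sqnorm H (u\<^sub>0 - w)"
    using H by (rule op_sqnorm_diff_le)
  then have "op_sqnorm H (u\<^sub>1 - u\<^sub>0) \<le> 2 * op_sqnorm H (u\<^sub>1 - w) + 2 * op_sqnorm H (w - u\<^sub>0)"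
    using op_sqnorm_minus_commute[OF psd_op_imp_self_adjoint[OF H], of u\<^sub>0 w] by simp
  then show ?thesis
    using mono expand split grad lower[of u\<^sub>1 w] lower[of w u\<^sub>0] upper[of u\<^sub>1 u\<^sub>0] by linarith
qed

text \<open>The reference point is now the previous step, which solves an inclusion with its own
  gradient. The gradient difference tested on \<open>w = u\<^sub>2 - u\<^sub>1\<close> is at least
  minus half of \<open>op_sqnorm P (e - w)\<close>, where \<open>e = u\<^sub>1 - u\<^sub>0\<close>.
  Expanding this square cancels the cross term \<open>e \<bullet> P w\<close> left by
  monotonicity.\<close>

lemma consecutive_prox_gradient_steps:
  fixes h :: "'a::euclidean_space \<Rightarrow> ereal"
  assumes h: "closed_proper_convex_on UNIV h"
    and H: "psd_op H" and H': "psd_op H'" and S: "psd_op S"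
    and lower: "\<And>u v. 1/2 * op_sqnorm H (u - v) \<le> f u - f v - Df v \<bullet> (u - v)"
    and upper: "\<And>u v. f u - f v - Df v \<bullet> (u - v) \<le> 1/2 * op_sqnorm H' (u - v)"
    and P: "P = (\<lambda>u. H' u + S u)"
    and step1: "d\<^sub>1 - Df u\<^sub>0 - a\<^sub>1 - P (u\<^sub>1 - u\<^sub>0) \<in> subdifferential h u\<^sub>1"
    and step2: "d\<^sub>2 - Df u\<^sub>1 - a\<^sub>2 - P (u\<^sub>2 - u\<^sub>1) \<in> subdifferential h u\<^sub>2"
  shows "(a\<^sub>2 - a\<^sub>1) \<bullet> (u\<^sub>2 - u\<^sub>1) + op_sqnorm P (u\<^sub>2 - u\<^sub>1) / 2
    \<le> (d\<^sub>2 - d\<^sub>1) \<bullet> (u\<^sub>2 - u\<^sub>1) + op_sqnorm P (u\<^sub>1 - u\<^sub>0) / 2"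
proof -
  define e w where "e = u\<^sub>1 - u\<^sub>0" and "w = u\<^sub>2 - u\<^sub>1"
  have adj: "self_adjoint P"
    unfolding P using H' S by (intro self_adjoint_add psd_op_imp_self_adjoint)
  have "0 \<le> ((d\<^sub>2 - Df u\<^sub>1 - a\<^sub>2 - P (u\<^sub>2 - u\<^sub>1)) - (d\<^sub>1 - Df u\<^sub>0 - a\<^sub>1 - P (u\<^sub>1 - u\<^sub>0))) \<bullet> (u\<^sub>2 - u\<^sub>1)"
    using h step2 step1 by (rule subdifferential_monotone)
  moreover have "P e \<bullet> w = e \<bullet> P w" "P w \<bullet> w = op_sqnorm P w"
    using self_adjoint_inner[OF adj] by (simp_all add: op_sqnorm_def)
  ultimately have mono: "(a\<^sub>2 - a\<^sub>1) \<bullet> w + op_sqnorm P w + Df u\<^sub>1 \<bullet> w - Df u\<^sub>0 \<bullet> w - e \<bullet> P w \<le> (d\<^sub>2 - d\<^sub>1) \<bullet> w"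
    by (simp add: inner_diff_left flip: e_def w_def)
  have "0 \<le> op_sqnorm H (u\<^sub>1 - w - u\<^sub>1)" "0 \<le> op_sqnorm H (u\<^sub>1 - u\<^sub>0)"
    using H by (simp_all add: op_sqnorm_nonneg)
  \<comment> \<open>The auxiliary point \<open>u\<^sub>1 - w\<close> is not an iterate. Its function
    value is bounded below by convexity and above by the majorization at \<open>u\<^sub>0\<close>,
    which eliminates all values of \<open>f\<close>.\<close>
  then have convex: "f u\<^sub>1 - Df u\<^sub>1 \<bullet> w \<le> f (u\<^sub>1 - w)" "f u\<^sub>0 + Df u\<^sub>0 \<bullet> e \<le> f u\<^sub>1"
    using lower[of "u\<^sub>1 - w" u\<^sub>1] lower[of u\<^sub>1 u\<^sub>0] by (simp_all add: e_def)
  have "op_sqnorm H' (e - w) \<le> op_sqnorm P (e - w)"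
    using op_sqnorm_nonneg[OF S, of "e - w"] by (simp add: P op_sqnorm_def inner_add_right)
  then have descent: "f (u\<^sub>1 - w) \<le> f u\<^sub>0 + Df u\<^sub>0 \<bullet> e - Df u\<^sub>0 \<bullet> w + 1/2 * op_sqnorm P (e - w)"
    using upper[of "u\<^sub>1 - w" u\<^sub>0] by (simp add: e_def algebra_simps)
  show ?thesis
    using mono convex descent op_sqnorm_diff[OF adj, of e w] unfolding e_def w_def by linarith
qed

section \<open>The dual step\<close>

definition coupling_gain :: "real \<Rightarrow> real" where
  "coupling_gain \<tau> = min \<tau> (1 + \<tau> - \<tau>\<^sup>2)"

definition residual_weight :: "real \<Rightarrow> real" where
  "residual_weight \<tau> = 1 - min \<tau> (1 / \<tau>)"

text \<open>Together with \<open>residual_weight\<close> this adds up to \<open>2 - \<tau>\<close>,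
  twice the coefficient of \<open>\<sigma> * (norm r)\<^sup>2\<close> that remains after the
  multiplier update. The weight part telescopes inside the energy; the gain part is a genuine
  decrease.\<close>

definition residual_gain :: "real \<Rightarrow> real" where
  "residual_gain \<tau> = 1 - \<tau> + min \<tau> (1 / \<tau>)"

text \<open>Completing the square: the claim is \<open>(2 * \<tau> - 1)\<^sup>2 < 5\<close>.\<close>

lemma golden_ratio_bound:
  fixes \<tau> :: real
  assumes "0 < \<tau>" "\<tau> < (1 + sqrt 5) / 2"
  shows "\<tau>\<^sup>2 < 1 + \<tau>"
proof -
  define s :: real where "s = sqrt 5"
  have "1 < s" "\<tau> * 2 < 1 + s"
    using assms by (simp_all add: s_def field_simps)
  then have "\<bar>2 * \<tau> - 1\<bar> < \<bar>s\<bar>"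
    using assms(1) by linarith
  then have "(2 * \<tau> - 1)\<^sup>2 < s\<^sup>2"
    by (rule power2_strict_mono)
  then show ?thesis
    by (simp add: s_def power2_eq_square algebra_simps)
qed

context
  fixes \<tau> :: real
  assumes pos: "0 < \<tau>" and golden: "\<tau>\<^sup>2 < 1 + \<tau>"
begin

text \<open>Both minima switch branches at \<open>\<tau> = 1\<close>.\<close>

lemma step_length_cases:
  obtains "\<tau> \<le> 1" "coupling_gain \<tau> = \<tau>" "residual_weight \<tau> = 1 - \<tau>" "residual_gain \<tau> = 1"
  | "1 < \<tau>" "coupling_gain \<tau> = 1 + \<tau> - \<tau>\<^sup>2" "residual_weight \<tau> = 1 - 1 / \<tau>"
    "residual_gain \<tau> = (1 + \<tau> - \<tau>\<^sup>2) / \<tau>"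
proof (cases "\<tau> \<le> 1")
  case True
  then have "\<tau>\<^sup>2 \<le> 1" "\<tau> \<le> 1 / \<tau>"
    using pos by (auto simp: field_simps power2_eq_square mult_le_one)
  then show ?thesis
    using True that(1) by (simp add: coupling_gain_def residual_weight_def residual_gain_def)
next
  case False
  then have "1 < \<tau>\<^sup>2" "1 / \<tau> \<le> \<tau>"
    using pos by (auto simp: field_simps power2_eq_square less_1_mult intro: less_imp_le)
  then show ?thesis
    using False pos that(2)
    by (simp add: coupling_gain_def residual_weight_def residual_gain_def field_simps power2_eq_square)
qed

lemma coupling_gain_pos: "0 < coupling_gain \<tau>"
  and residual_weight_nonneg: "0 \<le> residual_weight \<tau>"
  and residual_gain_pos: "0 < residual_gain \<tau>"
  using pos golden by (cases rule: step_length_cases; simp)+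

text \<open>Young's inequality with weights fitted to the step length: a nonnegative multiple of the
  square of \<open>u - v\<close> if \<open>\<tau> \<le> 1\<close>, and of
  \<open>\<tau> *\<^sub>R u + v\<close> otherwise. It absorbs the product of the last change in
  \<open>y\<close> with the previous residual.\<close>

lemma scaled_inner_le:
  fixes u v :: "'a::real_inner"
  shows "(1 - \<tau>) * (u \<bullet> v)
    \<le> (1 - coupling_gain \<tau>) / 2 * (norm u)\<^sup>2 + residual_weight \<tau> / 2 * (norm v)\<^sup>2"
proof (cases rule: step_length_cases)
  case 1
  have "0 \<le> (1 - \<tau>) * (norm (u - v))\<^sup>2"
    using 1 by simp
  also have "(norm (u - v))\<^sup>2 = (norm u)\<^sup>2 - 2 * (u \<bullet> v) + (norm v)\<^sup>2"
    by (simp add: power2_norm_eq_inner inner_diff_left inner_diff_right inner_commute)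
  finally show ?thesis
    unfolding 1(2,3) by (simp add: field_simps)
next
  case 2
  have "0 \<le> (\<tau> - 1) / \<tau> * (norm (\<tau> *\<^sub>R u + v))\<^sup>2"
    using 2 by simp
  also have "(norm (\<tau> *\<^sub>R u + v))\<^sup>2 = \<tau>\<^sup>2 * (norm u)\<^sup>2 + 2 * \<tau> * (u \<bullet> v) + (norm v)\<^sup>2"
    unfolding power2_norm_eq_inner
    by (simp add: inner_add_left inner_add_right inner_commute power2_eq_square)
  also have "(\<tau> - 1) / \<tau> * \<dots> = (\<tau>\<^sup>2 - \<tau>) * (norm u)\<^sup>2 + 2 * (\<tau> - 1) * (u \<bullet> v) + (1 - 1 / \<tau>) * (norm v)\<^sup>2"
    using pos by (simp add: field_simps power2_eq_square)
  finally show ?thesis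
    unfolding 2(2,3) by (simp add: field_simps)
qed

text \<open>
  Here \<open>e\<close> is the multiplier error, \<open>r\<^sub>0\<close> and \<open>r\<close> are consecutive residuals, \<open>v\<close> is \<open>B\<^sup>*\<close> applied
  to the error of \<open>y\<close>, and \<open>b\<close> is \<open>B\<^sup>*\<close> applied to the last change of \<open>y\<close>.
\<close>

lemma dual_step_lower_bound:
  fixes e r r\<^sub>0 b v :: "'a::real_inner"
  assumes \<sigma>: "0 < \<sigma>"
  shows "(norm (e + (\<tau> * \<sigma>) *\<^sub>R r))\<^sup>2 / (2 * \<tau> * \<sigma>) - (norm e)\<^sup>2 / (2 * \<tau> * \<sigma>)
      + \<sigma> / 2 * (norm v)\<^sup>2 - \<sigma> / 2 * (norm (v - b))\<^sup>2
      + \<sigma> / 2 * residual_weight \<tau> * (norm r)\<^sup>2 - \<sigma> / 2 * residual_weight \<tau> * (norm r\<^sub>0)\<^sup>2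
      + \<sigma> / 2 * residual_gain \<tau> * (norm r)\<^sup>2 + \<sigma> / 2 * coupling_gain \<tau> * (norm b)\<^sup>2
    \<le> (e + \<sigma> *\<^sub>R (r - b)) \<bullet> (r - v) + (e + \<sigma> *\<^sub>R r) \<bullet> v + (\<sigma> *\<^sub>R (r - (1 - \<tau>) *\<^sub>R r\<^sub>0)) \<bullet> b"
proof -
  have "(e + \<sigma> *\<^sub>R (r - b)) \<bullet> (r - v) + (e + \<sigma> *\<^sub>R r) \<bullet> v + (\<sigma> *\<^sub>R (r - (1 - \<tau>) *\<^sub>R r\<^sub>0)) \<bullet> b
      = e \<bullet> r + \<sigma> * (norm r)\<^sup>2 + \<sigma> * (b \<bullet> v) - \<sigma> * ((1 - \<tau>) * (b \<bullet> r\<^sub>0))"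
    unfolding power2_norm_eq_inner
    by (simp add: inner_add_left inner_add_right inner_diff_left inner_diff_right inner_commute algebra_simps)
  moreover have "\<sigma> * (b \<bullet> v) = \<sigma> / 2 * (norm v)\<^sup>2 - \<sigma> / 2 * (norm (v - b))\<^sup>2 + \<sigma> / 2 * (norm b)\<^sup>2"
    unfolding power2_norm_eq_inner
    by (simp add: inner_diff_left inner_diff_right inner_commute algebra_simps)
  moreover have "e \<bullet> r = (norm (e + (\<tau> * \<sigma>) *\<^sub>R r))\<^sup>2 / (2 * \<tau> * \<sigma>) - (norm e)\<^sup>2 / (2 * \<tau> * \<sigma>) - \<tau> * \<sigma> / 2 * (norm r)\<^sup>2"
    unfolding power2_norm_eq_inner using pos \<sigma>
    by (simp add: inner_add_left inner_add_right inner_commute field_simps)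
  moreover have "\<sigma> * ((1 - \<tau>) * (b \<bullet> r\<^sub>0)) \<le> \<sigma> / 2 * (norm b)\<^sup>2
      - \<sigma> / 2 * coupling_gain \<tau> * (norm b)\<^sup>2 + \<sigma> / 2 * residual_weight \<tau> * (norm r\<^sub>0)\<^sup>2"
    using mult_left_mono[OF scaled_inner_le[of b r\<^sub>0], of \<sigma>] \<sigma>
    by (simp add: algebra_simps diff_divide_distrib)
  moreover have "\<sigma> / 2 * residual_weight \<tau> * (norm r)\<^sup>2 + \<sigma> / 2 * residual_gain \<tau> * (norm r)\<^sup>2
      = \<sigma> * (norm r)\<^sup>2 - \<tau> * \<sigma> / 2 * (norm r)\<^sup>2"
    by (simp add: residual_weight_def residual_gain_def algebra_simps)
  ultimately show ?thesis
    by linarith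
qed

end

section \<open>Perturbed descent\<close>

text \<open>The error involves the unknown new value, so boundedness comes first:
  \<open>s k\<close>, the square root of \<open>\<Phi> k + D k\<close>, grows by at most
  \<open>\<eta> k\<close> per step. The errors are then dominated by a summable sequence.\<close>

lemma perturbed_descent:
  fixes \<Phi> D \<eta> :: "nat \<Rightarrow> real"
  assumes \<Phi>: "\<And>k. 0 \<le> \<Phi> k" and D: "\<And>k. 0 \<le> D k" and \<eta>: "\<And>k. 0 \<le> \<eta> k" "summable \<eta>"
    and step: "\<And>k. \<Phi> (Suc k) + D (Suc k) \<le> \<Phi> k + \<eta> k * sqrt (\<Phi> (Suc k) + D (Suc k))"
  shows "convergent \<Phi>" and "D \<longlonglongrightarrow> 0"
proof -
  define s where "s k = sqrt (\<Phi> k + D k)" for k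
  have s: "0 \<le> s k" "(s k)\<^sup>2 = \<Phi> k + D k" for k
    using \<Phi>[of k] D[of k] by (simp_all add: s_def)
  have s_Suc: "s (Suc k) \<le> s k + \<eta> k" for k
  proof (rule ccontr)
    assume "\<not> ?thesis"
    then have less: "s k < s (Suc k) - \<eta> k"
      by simp
    \<comment> \<open>The hypothesis bounds the right-hand side by \<open>\<Phi> k\<close>, hence by
      the square of \<open>s k\<close>, a contradiction.\<close>
    have "s k * s k < s (Suc k) * (s (Suc k) - \<eta> k)"
      using less s(1)[of k] \<eta>(1)[of k] by (intro mult_strict_mono') auto
    moreover have "(s (Suc k))\<^sup>2 \<le> \<Phi> k + \<eta> k * s (Suc k)"
      using step[of k] s(2)[of "Suc k"] by (simp add: s_def)
    ultimately show False
      using s(2)[of k] D[of k] by (simp add: power2_eq_square algebra_simps)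
  qed
  have "s k \<le> s 0 + (\<Sum>i<k. \<eta> i)" for k
  proof (induction k)
    case (Suc k)
    then show ?case
      using s_Suc[of k] by simp
  qed simp
  moreover have sum_le: "(\<Sum>i<k. \<eta> i) \<le> suminf \<eta>" for k
    using \<eta> by (intro sum_le_suminf) auto
  ultimately have bound: "s k \<le> s 0 + suminf \<eta>" for k
    by (meson add_left_mono order_trans)
  define M where "M = s 0 + suminf \<eta>"
  have M: "0 \<le> M"
    using s(1)[of 0] suminf_nonneg[OF \<eta>(2,1)] by (simp add: M_def)
  \<comment> \<open>Subtracting the accumulated error budget makes the sequence decreasing, and
    \<open>D (Suc k)\<close> is at most its decrement.\<close>
  define \<psi> where "\<psi> k = \<Phi> k - M * (\<Sum>i<k. \<eta> i)" for k
  have \<psi>_Suc: "\<psi> (Suc k) + D (Suc k) \<le> \<psi> k" for k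
  proof -
    have "\<eta> k * s (Suc k) \<le> \<eta> k * M"
      using \<eta>(1) bound by (simp add: mult_left_mono M_def)
    then show ?thesis
      using step[of k] by (simp add: \<psi>_def s_def algebra_simps)
  qed
  have "decseq \<psi>"
    using \<psi>_Suc D by (intro decseq_SucI) (meson add_le_same_cancel1 le_add_same_cancel1 order_trans)
  moreover have "- M * suminf \<eta> \<le> \<psi> k" for k
    using mult_left_mono[OF sum_le[of k] M] \<Phi>[of k] by (simp add: \<psi>_def)
  ultimately obtain L where L: "\<psi> \<longlonglongrightarrow> L"
    using decseq_convergent by metis
  have "(\<lambda>k. \<psi> k + M * (\<Sum>i<k. \<eta> i)) \<longlonglongrightarrow> L + M * suminf \<eta>"
    using L summable_LIMSEQ[OF \<eta>(2)] by (intro tendsto_intros)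
  then show "convergent \<Phi>"
    by (auto simp: \<psi>_def convergent_def)
  have "(\<lambda>k. \<psi> k - \<psi> (Suc k)) \<longlonglongrightarrow> L - L"
    using L LIMSEQ_Suc[OF L] by (intro tendsto_intros)
  then have "(\<lambda>k. D (Suc k)) \<longlonglongrightarrow> 0"
    using D \<psi>_Suc by (intro tendsto_sandwich[of "\<lambda>_. 0" "\<lambda>k. D (Suc k)" sequentially "\<lambda>k. \<psi> k - \<psi> (Suc k)" 0])
      (auto simp: algebra_simps)
  then show "D \<longlonglongrightarrow> 0"
    by (simp only: filterlim_sequentially_Suc)
qed

section \<open>Convergence of the iterates\<close>

lemma norm_le_sqrt_mult_sqrt:
  assumes "(norm u)\<^sup>2 \<le> C * E" "C \<le> C'" "0 \<le> E"
  shows "norm u \<le> sqrt C' * sqrt E"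
proof -
  have "(norm u)\<^sup>2 \<le> C' * E"
    using assms mult_right_mono by fastforce
  then show ?thesis
    by (simp add: real_le_rsqrt flip: real_sqrt_mult)
qed

lemma norm_diff_sq_le: "(norm (u - v))\<^sup>2 \<le> 2 * (norm u)\<^sup>2 + 2 * (norm v)\<^sup>2"
  for u v :: "'a::real_inner"
  using zero_le_power2[of "norm (u + v)"]
  by (simp add: power2_norm_eq_inner inner_add_left inner_add_right inner_diff_left inner_diff_right inner_commute)

text \<open>
  \<open>dx k\<close> and \<open>dy k\<close> are the subgradient errors of the inexact steps, and the proximal terms are
  rewritten in terms of \<open>P\<close> and \<open>Q\<close>, that is, \<open>M\<close> and \<open>N\<close> without their coupling parts.
\<close>

locale imsPADMM_run =
  fixes p :: "'x::euclidean_space \<Rightarrow> ereal" and q :: "'y::euclidean_space \<Rightarrow> ereal"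
    and f :: "'x \<Rightarrow> real" and g :: "'y \<Rightarrow> real"
    and Df :: "'x \<Rightarrow> 'x" and Dg :: "'y \<Rightarrow> 'y"
    and A :: "'z::euclidean_space \<Rightarrow> 'x" and B :: "'z \<Rightarrow> 'y" and c :: 'z
    and Sf Sf' S P :: "'x \<Rightarrow> 'x" and Sg Sg' T Q :: "'y \<Rightarrow> 'y"
    and \<sigma> \<tau> :: real
    and dx x :: "nat \<Rightarrow> 'x" and dy y :: "nat \<Rightarrow> 'y" and z :: "nat \<Rightarrow> 'z"
    and res :: "nat \<Rightarrow> 'z"
  assumes p: "closed_proper_convex_on UNIV p" and q: "closed_proper_convex_on UNIV q"
    and Df: "continuous_on UNIV Df" and Dg: "continuous_on UNIV Dg"
    and A: "linear A" and B: "linear B"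
    and psd: "psd_op Sf" "psd_op Sf'" "psd_op S" "psd_op Sg" "psd_op Sg'" "psd_op T"
    and f_lower: "\<And>u u'. 1/2 * op_sqnorm Sf (u - u') \<le> f u - f u' - Df u' \<bullet> (u - u')"
    and f_upper: "\<And>u u'. f u - f u' - Df u' \<bullet> (u - u') \<le> 1/2 * op_sqnorm Sf' (u - u')"
    and g_lower: "\<And>v v'. 1/2 * op_sqnorm Sg (v - v') \<le> g v - g v' - Dg v' \<bullet> (v - v')"
    and g_upper: "\<And>v v'. g v - g v' - Dg v' \<bullet> (v - v') \<le> 1/2 * op_sqnorm Sg' (v - v')"
    and \<sigma>: "0 < \<sigma>" and \<tau>: "0 < \<tau>" and golden: "\<tau>\<^sup>2 < 1 + \<tau>"
    and M: "pd_op (\<lambda>u. Sf' u + S u + \<sigma> *\<^sub>R A (adjoint A u))"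
    and N: "pd_op (\<lambda>v. Sg' v + T v + \<sigma> *\<^sub>R B (adjoint B v))"
    and M': "pd_op (\<lambda>u. Sf u + S u + \<sigma> *\<^sub>R A (adjoint A u))"
    and N': "pd_op (\<lambda>v. Sg v + T v + \<sigma> *\<^sub>R B (adjoint B v))"
    and P: "P = (\<lambda>u. Sf' u + S u)" and Q: "Q = (\<lambda>v. Sg' v + T v)"
    and res: "res = (\<lambda>k. adjoint A (x k) + adjoint B (y k) - c)"
    and x_step: "\<And>k. dx k - Df (x k) - A (z k + \<sigma> *\<^sub>R (res (Suc k) - adjoint B (y (Suc k) - y k)))
      - P (x (Suc k) - x k) \<in> subdifferential p (x (Suc k))"
    and y_step: "\<And>k. dy k - Dg (y k) - B (z k + \<sigma> *\<^sub>R res (Suc k))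
      - Q (y (Suc k) - y k) \<in> subdifferential q (y (Suc k))"
    and z_step: "\<And>k. z (Suc k) = z k + (\<tau> * \<sigma>) *\<^sub>R res (Suc k)"
    and dx: "summable (\<lambda>k. norm (dx k))" and dy: "summable (\<lambda>k. norm (dy k))"
begin

section \<open>The energy and its decrease in one iteration\<close>

text \<open>The energy is attached to the iterate \<open>Suc k\<close>, so that the last step in
  \<open>y\<close> exists and obeys an inclusion. Its last two summands store what the comparison of
  consecutive \<open>y\<close>-steps and the absorption of the previous residual cost in the next
  iteration.\<close>

definition lyapunov :: "'x \<Rightarrow> 'y \<Rightarrow> 'z \<Rightarrow> nat \<Rightarrow> real" where
  "lyapunov u v w k =
     op_sqnorm P (x (Suc k) - u) / 2 + op_sqnorm Q (y (Suc k) - v) / 2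
     + \<sigma> / 2 * (norm (adjoint B (y (Suc k) - v)))\<^sup>2
     + (norm (z (Suc k) - w))\<^sup>2 / (2 * \<tau> * \<sigma>)
     + op_sqnorm Q (y (Suc k) - y k) / 2 + \<sigma> / 2 * residual_weight \<tau> * (norm (res (Suc k)))\<^sup>2"

definition decrease :: "nat \<Rightarrow> real" where
  "decrease k =
     op_sqnorm S (x (Suc k) - x k) / 2 + op_sqnorm Sf (x (Suc k) - x k) / 4
     + op_sqnorm T (y (Suc k) - y k) / 2 + op_sqnorm Sg (y (Suc k) - y k) / 4
     + \<sigma> / 2 * residual_gain \<tau> * (norm (res (Suc k)))\<^sup>2
     + \<sigma> / 2 * coupling_gain \<tau> * (norm (adjoint B (y (Suc k) - y k)))\<^sup>2"

lemmas gains = coupling_gain_pos[OF \<tau> golden] residual_gain_pos[OF \<tau> golden]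
  residual_weight_nonneg[OF \<tau> golden]

lemma psd_PQ: "psd_op P" "psd_op Q"
  unfolding P Q using psd by (auto intro: psd_op_add)

lemma linear_adjoints: "linear (adjoint A)" "linear (adjoint B)"
  using A B by (auto intro: adjoint_linear)

lemma linear_PQ: "linear P" "linear Q"
  using psd_PQ by (auto intro: self_adjoint_imp_linear psd_op_imp_self_adjoint)

lemma tendsto_operators:
  "e \<longlonglongrightarrow> e' \<Longrightarrow> (\<lambda>j. P (e j)) \<longlonglongrightarrow> P e'" "d \<longlonglongrightarrow> d' \<Longrightarrow> (\<lambda>j. Q (d j)) \<longlonglongrightarrow> Q d'"
  "e \<longlonglongrightarrow> e' \<Longrightarrow> (\<lambda>j. adjoint A (e j)) \<longlonglongrightarrow> adjoint A e'"
  "d \<longlonglongrightarrow> d' \<Longrightarrow> (\<lambda>j. adjoint B (d j)) \<longlonglongrightarrow> adjoint B d'"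
  "t \<longlonglongrightarrow> t' \<Longrightarrow> (\<lambda>j. A (t j)) \<longlonglongrightarrow> A t'" "t \<longlonglongrightarrow> t' \<Longrightarrow> (\<lambda>j. B (t j)) \<longlonglongrightarrow> B t'"
  using linear_PQ linear_adjoints A B by (simp_all add: bounded_linear.tendsto linear_conv_bounded_linear)

lemma lyapunov_bounds:
  "0 \<le> lyapunov u v w k"
  "op_sqnorm P (x (Suc k) - u) / 2 \<le> lyapunov u v w k"
  "op_sqnorm Q (y (Suc k) - v) / 2 \<le> lyapunov u v w k"
  "\<sigma> / 2 * (norm (adjoint B (y (Suc k) - v)))\<^sup>2 \<le> lyapunov u v w k"
  "(norm (z (Suc k) - w))\<^sup>2 / (2 * \<tau> * \<sigma>) \<le> lyapunov u v w k"
proof -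
  have "0 \<le> op_sqnorm P (x (Suc k) - u)" "0 \<le> op_sqnorm Q (y (Suc k) - v)"
    "0 \<le> \<sigma> / 2 * (norm (adjoint B (y (Suc k) - v)))\<^sup>2" "0 \<le> (norm (z (Suc k) - w))\<^sup>2 / (2 * \<tau> * \<sigma>)"
    "0 \<le> op_sqnorm Q (y (Suc k) - y k)" "0 \<le> \<sigma> / 2 * residual_weight \<tau> * (norm (res (Suc k)))\<^sup>2"
    using psd_PQ \<sigma> \<tau> gains by (simp_all add: op_sqnorm_nonneg)
  then show "0 \<le> lyapunov u v w k"
    "op_sqnorm P (x (Suc k) - u) / 2 \<le> lyapunov u v w k"
    "op_sqnorm Q (y (Suc k) - v) / 2 \<le> lyapunov u v w k"
    "\<sigma> / 2 * (norm (adjoint B (y (Suc k) - v)))\<^sup>2 \<le> lyapunov u v w k"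
    "(norm (z (Suc k) - w))\<^sup>2 / (2 * \<tau> * \<sigma>) \<le> lyapunov u v w k"
    unfolding lyapunov_def by linarith+
qed

lemma decrease_bounds:
  "0 \<le> decrease k"
  "op_sqnorm S (x (Suc k) - x k) / 2 \<le> decrease k"
  "op_sqnorm Sf (x (Suc k) - x k) / 4 \<le> decrease k"
  "op_sqnorm T (y (Suc k) - y k) / 2 \<le> decrease k"
  "op_sqnorm Sg (y (Suc k) - y k) / 4 \<le> decrease k"
  "\<sigma> / 2 * residual_gain \<tau> * (norm (res (Suc k)))\<^sup>2 \<le> decrease k"
  "\<sigma> / 2 * coupling_gain \<tau> * (norm (adjoint B (y (Suc k) - y k)))\<^sup>2 \<le> decrease k"
proof -
  have "0 \<le> op_sqnorm S (x (Suc k) - x k)" "0 \<le> op_sqnorm Sf (x (Suc k) - x k)"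
    "0 \<le> op_sqnorm T (y (Suc k) - y k)" "0 \<le> op_sqnorm Sg (y (Suc k) - y k)"
    "0 \<le> \<sigma> / 2 * residual_gain \<tau> * (norm (res (Suc k)))\<^sup>2"
    "0 \<le> \<sigma> / 2 * coupling_gain \<tau> * (norm (adjoint B (y (Suc k) - y k)))\<^sup>2"
    using psd \<sigma> gains by (simp_all add: op_sqnorm_nonneg)
  then show "0 \<le> decrease k"
    "op_sqnorm S (x (Suc k) - x k) / 2 \<le> decrease k"
    "op_sqnorm Sf (x (Suc k) - x k) / 4 \<le> decrease k"
    "op_sqnorm T (y (Suc k) - y k) / 2 \<le> decrease k"
    "op_sqnorm Sg (y (Suc k) - y k) / 4 \<le> decrease k"
    "\<sigma> / 2 * residual_gain \<tau> * (norm (res (Suc k)))\<^sup>2 \<le> decrease k"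
    "\<sigma> / 2 * coupling_gain \<tau> * (norm (adjoint B (y (Suc k) - y k)))\<^sup>2 \<le> decrease k"
    unfolding decrease_def by linarith+
qed

lemma decrease_coupling_bounds:
  "\<sigma> * (norm (res (Suc k)))\<^sup>2 \<le> 2 / residual_gain \<tau> * decrease k"
  "\<sigma> * (norm (adjoint B (y (Suc k) - y k)))\<^sup>2 \<le> 2 / coupling_gain \<tau> * decrease k"
  using decrease_bounds(6,7)[of k] gains by (simp_all add: field_simps)

text \<open>The energy has no term in \<open>adjoint A\<close>; for a feasible pair this identity
  recovers the error in \<open>x\<close> from the residual and the error in
  \<open>y\<close>.\<close>

lemma res_minus_coupling:
  assumes "adjoint A u + adjoint B v = c"
  shows "res k - adjoint B (y k - v) = adjoint A (x k - u)"
  unfolding res using assms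
  by (simp add: linear_diff[OF linear_adjoints(1)] linear_diff[OF linear_adjoints(2)] algebra_simps)

lemma KKT_D:
  assumes "(u, v, w) \<in> KKT_solutions p q Df Dg A B c"
  shows "- Df u - A w \<in> subdifferential p u" "- Dg v - B w \<in> subdifferential q v"
    "adjoint A u + adjoint B v = c"
proof -
  obtain d e where "d \<in> subdifferential p u" "0 = d + Df u + A w"
    "e \<in> subdifferential q v" "0 = e + Dg v + B w"
    using assms by (auto simp: KKT_solutions_def)
  moreover from this have "d = - Df u - A w" "e = - Dg v - B w"
    by (simp_all add: algebra_simps eq_neg_iff_add_eq_0)
  ultimately show "- Df u - A w \<in> subdifferential p u" "- Dg v - B w \<in> subdifferential q v"
    by simp_all
  show "adjoint A u + adjoint B v = c"
    using assms by (simp add: KKT_solutions_def)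
qed

text \<open>Sum of four estimates: the two proximal steps against the KKT point, the two consecutive
  \<open>y\<close>-steps against each other, and the dual bound. Moving \<open>A\<close> and
  \<open>B\<close> across the inner products by adjoints makes the three products of the primal
  estimates exactly the right-hand side of \<open>dual_step_lower_bound\<close>.\<close>

lemma lyapunov_step:
  assumes "(u, v, w) \<in> KKT_solutions p q Df Dg A B c"
  shows "lyapunov u v w (Suc k) + decrease (Suc k)
    \<le> lyapunov u v w k + dx (Suc k) \<bullet> (x (Suc (Suc k)) - u) + dy (Suc k) \<bullet> (y (Suc (Suc k)) - v)
      + (dy (Suc k) - dy k) \<bullet> (y (Suc (Suc k)) - y (Suc k))"
proof -
  note KKT = KKT_D[OF assms]
  define e r r\<^sub>0 b s where "e = z (Suc k) - w" and "r = res (Suc (Suc k))" and "r\<^sub>0 = res (Suc k)"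
    and "b = adjoint B (y (Suc (Suc k)) - y (Suc k))" and "s = adjoint B (y (Suc (Suc k)) - v)"
  have rs: "r - s = adjoint A (x (Suc (Suc k)) - u)"
    unfolding r_def s_def by (rule res_minus_coupling[OF KKT(3)])
  have "(A (z (Suc k) + \<sigma> *\<^sub>R (r - b)) - A w) \<bullet> (x (Suc (Suc k)) - u)
      + op_sqnorm P (x (Suc (Suc k)) - u) / 2
      + op_sqnorm S (x (Suc (Suc k)) - x (Suc k)) / 2 + op_sqnorm Sf (x (Suc (Suc k)) - x (Suc k)) / 4
    \<le> dx (Suc k) \<bullet> (x (Suc (Suc k)) - u) + op_sqnorm P (x (Suc k) - u) / 2"
    using p psd(1) psd_op_imp_self_adjoint[OF psd(2)] psd_op_imp_self_adjoint[OF psd(3)]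
      f_lower f_upper P x_step[of "Suc k"] KKT(1)
    unfolding r_def b_def by (rule prox_gradient_step)
  moreover have "(A (z (Suc k) + \<sigma> *\<^sub>R (r - b)) - A w) \<bullet> (x (Suc (Suc k)) - u) = (e + \<sigma> *\<^sub>R (r - b)) \<bullet> (r - s)"
    unfolding rs adjoint_works[OF A] e_def by (simp add: linear_diff[OF A, symmetric] algebra_simps)
  moreover have "(B (z (Suc k) + \<sigma> *\<^sub>R r) - B w) \<bullet> (y (Suc (Suc k)) - v)
      + op_sqnorm Q (y (Suc (Suc k)) - v) / 2
      + op_sqnorm T (y (Suc (Suc k)) - y (Suc k)) / 2 + op_sqnorm Sg (y (Suc (Suc k)) - y (Suc k)) / 4
    \<le> dy (Suc k) \<bullet> (y (Suc (Suc k)) - v) + op_sqnorm Q (y (Suc k) - v) / 2"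
    using q psd(4) psd_op_imp_self_adjoint[OF psd(5)] psd_op_imp_self_adjoint[OF psd(6)]
      g_lower g_upper Q y_step[of "Suc k"] KKT(2)
    unfolding r_def by (rule prox_gradient_step)
  moreover have "(B (z (Suc k) + \<sigma> *\<^sub>R r) - B w) \<bullet> (y (Suc (Suc k)) - v) = (e + \<sigma> *\<^sub>R r) \<bullet> s"
    unfolding s_def adjoint_works[OF B] e_def by (simp add: linear_diff[OF B, symmetric] algebra_simps)
  moreover have "(B (z (Suc k) + \<sigma> *\<^sub>R r) - B (z k + \<sigma> *\<^sub>R r\<^sub>0)) \<bullet> (y (Suc (Suc k)) - y (Suc k))
      + op_sqnorm Q (y (Suc (Suc k)) - y (Suc k)) / 2
    \<le> (dy (Suc k) - dy k) \<bullet> (y (Suc (Suc k)) - y (Suc k)) + op_sqnorm Q (y (Suc k) - y k) / 2"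
    using q psd(4-6) g_lower g_upper Q y_step[of k] y_step[of "Suc k"]
    unfolding r_def r\<^sub>0_def by (rule consecutive_prox_gradient_steps)
  \<comment> \<open>The multiplier update contributes
    \<open>(\<tau> * \<sigma>) *\<^sub>R r\<^sub>0\<close>, which leaves the factor
    \<open>1 - \<tau>\<close> on the old residual.\<close>
  moreover have "(B (z (Suc k) + \<sigma> *\<^sub>R r) - B (z k + \<sigma> *\<^sub>R r\<^sub>0)) \<bullet> (y (Suc (Suc k)) - y (Suc k))
      = (\<sigma> *\<^sub>R (r - (1 - \<tau>) *\<^sub>R r\<^sub>0)) \<bullet> b"
    unfolding b_def adjoint_works[OF B] by (simp add: linear_diff[OF B, symmetric] z_step r\<^sub>0_def algebra_simps)
  moreover have "(norm (z (Suc (Suc k)) - w))\<^sup>2 / (2 * \<tau> * \<sigma>) - (norm (z (Suc k) - w))\<^sup>2 / (2 * \<tau> * \<sigma>)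
      + \<sigma> / 2 * (norm s)\<^sup>2 - \<sigma> / 2 * (norm (adjoint B (y (Suc k) - v)))\<^sup>2
      + \<sigma> / 2 * residual_weight \<tau> * (norm r)\<^sup>2 - \<sigma> / 2 * residual_weight \<tau> * (norm r\<^sub>0)\<^sup>2
      + \<sigma> / 2 * residual_gain \<tau> * (norm r)\<^sup>2 + \<sigma> / 2 * coupling_gain \<tau> * (norm b)\<^sup>2
    \<le> (e + \<sigma> *\<^sub>R (r - b)) \<bullet> (r - s) + (e + \<sigma> *\<^sub>R r) \<bullet> s + (\<sigma> *\<^sub>R (r - (1 - \<tau>) *\<^sub>R r\<^sub>0)) \<bullet> b"
  proof -
    have "z (Suc (Suc k)) - w = e + (\<tau> * \<sigma>) *\<^sub>R r"
      using z_step[of "Suc k"] by (simp add: e_def r_def)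
    moreover have "adjoint B (y (Suc k) - v) = s - b"
      by (simp add: s_def b_def linear_diff[OF linear_adjoints(2), symmetric])
    ultimately show ?thesis
      using dual_step_lower_bound[OF \<tau> golden \<sigma>, of e r s b r\<^sub>0] by (simp only: e_def)
  qed
  ultimately show ?thesis
    unfolding lyapunov_def decrease_def r_def[symmetric] r\<^sub>0_def[symmetric] b_def[symmetric] s_def[symmetric]
    by linarith
qed

section \<open>Errors and steps controlled by the energy and its decrease\<close>

text \<open>Supplies the square-root bounds that turn the inexactness terms into the form required
  by \<open>perturbed_descent\<close>. Positive definiteness of \<open>M\<close> and
  \<open>N\<close> controls the errors in \<open>x\<close> and \<open>y\<close>. For the change in
  \<open>y\<close> the operator with the minorant \<open>Sg\<close> is used, as it matches the
  summands of \<open>decrease\<close>.\<close>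

lemma error_bounds:
  assumes uv: "adjoint A u + adjoint B v = c"
  obtains K where "0 \<le> K" "\<And>k. norm (x (Suc k) - u) \<le> K * sqrt (lyapunov u v w k + decrease k)"
    "\<And>k. norm (y (Suc k) - v) \<le> K * sqrt (lyapunov u v w k + decrease k)"
    "\<And>k. norm (z (Suc k) - w) \<le> K * sqrt (lyapunov u v w k + decrease k)"
    "\<And>k. norm (y (Suc k) - y k) \<le> K * sqrt (lyapunov u v w k + decrease k)"
proof -
  obtain \<mu> where \<mu>: "0 < \<mu>" "\<And>a. \<mu> * (norm a)\<^sup>2 \<le> op_sqnorm (\<lambda>u. Sf' u + S u + \<sigma> *\<^sub>R A (adjoint A u)) a"
    using pd_op_lower_bound[OF M] by blast
  obtain \<nu> where \<nu>: "0 < \<nu>" "\<And>a. \<nu> * (norm a)\<^sup>2 \<le> op_sqnorm (\<lambda>v. Sg' v + T v + \<sigma> *\<^sub>R B (adjoint B v)) a"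
    using pd_op_lower_bound[OF N] by blast
  obtain \<kappa> where \<kappa>: "0 < \<kappa>" "\<And>a. \<kappa> * (norm a)\<^sup>2 \<le> op_sqnorm (\<lambda>v. Sg v + T v + \<sigma> *\<^sub>R B (adjoint B v)) a"
    using pd_op_lower_bound[OF N'] by blast
  define E where "E k = lyapunov u v w k + decrease k" for k
  \<comment> \<open>In \<open>Cx\<close> the number 6 is 2 from the \<open>P\<close> term plus 4
    from the error in \<open>y\<close> seen through \<open>adjoint B\<close>; in \<open>Cd\<close>
    it is 2 from \<open>T\<close> plus 4 from \<open>Sg\<close>.\<close>
  define Cx where "Cx = (6 + 4 / residual_gain \<tau>) / \<mu>"
  define Cy where "Cy = 4 / \<nu>"
  define Cd where "Cd = (6 + 2 / coupling_gain \<tau>) / \<kappa>"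
  define C where "C = Cx + Cy + 2 * \<tau> * \<sigma> + Cd"
  have nonneg: "0 \<le> Cx" "0 \<le> Cy" "0 \<le> 2 * \<tau> * \<sigma>" "0 \<le> Cd"
    using \<mu> \<nu> \<kappa> gains \<sigma> \<tau> by (simp_all add: Cx_def Cy_def Cd_def)
  have E: "0 \<le> E k" for k
    using lyapunov_bounds(1)[of u v w k] decrease_bounds(1)[of k] by (simp add: E_def)
  have parts: "op_sqnorm P (x (Suc k) - u) \<le> 2 * E k" "op_sqnorm Q (y (Suc k) - v) \<le> 2 * E k"
    "\<sigma> * (norm (adjoint B (y (Suc k) - v)))\<^sup>2 \<le> 2 * E k" "(norm (z (Suc k) - w))\<^sup>2 / (2 * \<tau> * \<sigma>) \<le> E k"
    "op_sqnorm T (y (Suc k) - y k) \<le> 2 * E k" "op_sqnorm Sg (y (Suc k) - y k) \<le> 4 * E k" for k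
    using lyapunov_bounds[where u=u and v=v and w=w and k=k] decrease_bounds[of k] unfolding E_def by simp_all
  have le_E: "C * decrease k \<le> C * E k" if "0 \<le> C" for C k
    using that lyapunov_bounds(1)[of u v w k] by (simp add: E_def mult_left_mono)
  have res_le: "\<sigma> * (norm (res (Suc k)))\<^sup>2 \<le> 2 / residual_gain \<tau> * E k" for k
    using decrease_coupling_bounds(1)[of k] le_E[of "2 / residual_gain \<tau>" k] gains by simp
  have coupling_le: "\<sigma> * (norm (adjoint B (y (Suc k) - y k)))\<^sup>2 \<le> 2 / coupling_gain \<tau> * E k" for k
    using decrease_coupling_bounds(2)[of k] le_E[of "2 / coupling_gain \<tau>" k] gains by simp
  have x_bound: "(norm (x (Suc k) - u))\<^sup>2 \<le> Cx * E k" for k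
  proof -
    have "(norm (adjoint A (x (Suc k) - u)))\<^sup>2 \<le> 2 * (norm (res (Suc k)))\<^sup>2 + 2 * (norm (adjoint B (y (Suc k) - v)))\<^sup>2"
      unfolding res_minus_coupling[OF uv, symmetric] by (rule norm_diff_sq_le)
    then have "\<sigma> * (norm (adjoint A (x (Suc k) - u)))\<^sup>2
        \<le> \<sigma> * (2 * (norm (res (Suc k)))\<^sup>2 + 2 * (norm (adjoint B (y (Suc k) - v)))\<^sup>2)"
      using \<sigma> by (intro mult_left_mono) simp_all
    also have "\<dots> = 2 * (\<sigma> * (norm (res (Suc k)))\<^sup>2) + 2 * (\<sigma> * (norm (adjoint B (y (Suc k) - v)))\<^sup>2)"
      by (simp add: algebra_simps)
    also have "\<dots> \<le> 2 * (2 / residual_gain \<tau> * E k) + 2 * (2 * E k)"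
      using res_le[of k] parts(3)[of k] by linarith
    finally have "\<mu> * (norm (x (Suc k) - u))\<^sup>2 \<le> 6 * E k + 4 / residual_gain \<tau> * E k"
      using \<mu>(2)[of "x (Suc k) - u"] parts(1)[of k]
      by (simp add: P op_sqnorm_def inner_add_right inner_compose_adjoint[OF A])
    then show ?thesis
      using \<mu>(1) by (simp add: Cx_def pos_le_divide_eq algebra_simps)
  qed
  have y_bound: "(norm (y (Suc k) - v))\<^sup>2 \<le> Cy * E k" for k
    using \<nu>(1) \<nu>(2)[of "y (Suc k) - v"] parts(2)[of k] parts(3)[of k]
    by (simp add: Cy_def Q op_sqnorm_def inner_add_right inner_compose_adjoint[OF B] pos_le_divide_eq algebra_simps)
  have z_bound: "(norm (z (Suc k) - w))\<^sup>2 \<le> 2 * \<tau> * \<sigma> * E k" for k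
    using parts(4)[of k] \<sigma> \<tau> by (simp add: field_simps)
  have d_bound: "(norm (y (Suc k) - y k))\<^sup>2 \<le> Cd * E k" for k
  proof -
    have "\<kappa> * (norm (y (Suc k) - y k))\<^sup>2 \<le> 6 * E k + 2 / coupling_gain \<tau> * E k"
      using \<kappa>(2)[of "y (Suc k) - y k"] parts(5)[of k] parts(6)[of k] coupling_le[of k]
      by (simp add: op_sqnorm_def inner_add_right inner_compose_adjoint[OF B])
    then show ?thesis
      using \<kappa>(1) by (simp add: Cd_def pos_le_divide_eq algebra_simps)
  qed
  have C: "Cx \<le> C" "Cy \<le> C" "2 * \<tau> * \<sigma> \<le> C" "Cd \<le> C"
    using nonneg by (simp_all add: C_def)
  show ?thesis
  proof (rule that[of "sqrt C"])
    show "0 \<le> sqrt C"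
      using nonneg C by simp
  qed (use norm_le_sqrt_mult_sqrt[OF x_bound C(1) E] norm_le_sqrt_mult_sqrt[OF y_bound C(2) E]
      norm_le_sqrt_mult_sqrt[OF z_bound C(3) E] norm_le_sqrt_mult_sqrt[OF d_bound C(4) E] in \<open>simp_all add: E_def\<close>)
qed

text \<open>Here the positive definiteness assumptions with the minorants \<open>Sf\<close> and
  \<open>Sg\<close> enter, since these are the forms that \<open>decrease\<close> contains. The part
  of the \<open>x\<close>-step seen by \<open>adjoint A\<close> is rebuilt from two consecutive
  residuals and the change in \<open>y\<close>, hence the two consecutive values of
  \<open>decrease\<close>.\<close>

lemma step_bounds:
  obtains K where
    "\<And>k. norm (x (Suc (Suc k)) - x (Suc k)) \<le> K * sqrt (decrease (Suc k) + decrease k)"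
    "\<And>k. norm (y (Suc k) - y k) \<le> K * sqrt (decrease k)"
    "\<And>k. norm (res (Suc k)) \<le> K * sqrt (decrease k)"
proof -
  obtain \<mu> where \<mu>: "0 < \<mu>" "\<And>a. \<mu> * (norm a)\<^sup>2 \<le> op_sqnorm (\<lambda>u. Sf u + S u + \<sigma> *\<^sub>R A (adjoint A u)) a"
    using pd_op_lower_bound[OF M'] by blast
  obtain \<kappa> where \<kappa>: "0 < \<kappa>" "\<And>a. \<kappa> * (norm a)\<^sup>2 \<le> op_sqnorm (\<lambda>v. Sg v + T v + \<sigma> *\<^sub>R B (adjoint B v)) a"
    using pd_op_lower_bound[OF N'] by blast
  define \<rho> \<gamma> where "\<rho> = 2 / residual_gain \<tau>" and "\<gamma> = 2 / coupling_gain \<tau>"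
  have pos: "0 < \<rho>" "0 < \<gamma>"
    using gains by (simp_all add: \<rho>_def \<gamma>_def)
  have parts: "op_sqnorm S (x (Suc k) - x k) \<le> 2 * decrease k" "op_sqnorm Sf (x (Suc k) - x k) \<le> 4 * decrease k"
    "op_sqnorm T (y (Suc k) - y k) \<le> 2 * decrease k" "op_sqnorm Sg (y (Suc k) - y k) \<le> 4 * decrease k" for k
    using decrease_bounds[of k] by simp_all
  note res_le = decrease_coupling_bounds(1)[folded \<rho>_def] and coupling_le = decrease_coupling_bounds(2)[folded \<gamma>_def]
  define Cx where "Cx = (6 + 4 * \<rho> + 2 * \<gamma>) / \<mu>"
  define Cy where "Cy = (6 + \<gamma>) / \<kappa>"
  define C where "C = Cx + Cy + \<rho> / \<sigma>"
  have nonneg: "0 \<le> Cx" "0 \<le> Cy" "0 \<le> \<rho> / \<sigma>"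
    using \<mu> \<kappa> pos \<sigma> by (simp_all add: Cx_def Cy_def)
  have x_bound: "(norm (x (Suc (Suc k)) - x (Suc k)))\<^sup>2 \<le> Cx * (decrease (Suc k) + decrease k)" for k
  proof -
    let ?a = "adjoint A (x (Suc (Suc k)) - x (Suc k))" and ?b = "adjoint B (y (Suc (Suc k)) - y (Suc k))"
    let ?D = "decrease (Suc k) + decrease k"
    have "?a = (res (Suc (Suc k)) - res (Suc k)) - ?b"
      unfolding res by (simp add: linear_diff[OF linear_adjoints(1)] linear_diff[OF linear_adjoints(2)])
    then have "(norm ?a)\<^sup>2 \<le> 2 * (norm (res (Suc (Suc k)) - res (Suc k)))\<^sup>2 + 2 * (norm ?b)\<^sup>2"
      by (metis norm_diff_sq_le)
    also have "(norm (res (Suc (Suc k)) - res (Suc k)))\<^sup>2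
        \<le> 2 * (norm (res (Suc (Suc k))))\<^sup>2 + 2 * (norm (res (Suc k)))\<^sup>2"
      by (rule norm_diff_sq_le)
    finally have "(norm ?a)\<^sup>2
        \<le> 4 * (norm (res (Suc (Suc k))))\<^sup>2 + 4 * (norm (res (Suc k)))\<^sup>2 + 2 * (norm ?b)\<^sup>2"
      by simp
    then have "\<sigma> * (norm ?a)\<^sup>2
        \<le> \<sigma> * (4 * (norm (res (Suc (Suc k))))\<^sup>2 + 4 * (norm (res (Suc k)))\<^sup>2 + 2 * (norm ?b)\<^sup>2)"
      using \<sigma> by (intro mult_left_mono) simp_all
    also have "\<dots> = 4 * (\<sigma> * (norm (res (Suc (Suc k))))\<^sup>2) + 4 * (\<sigma> * (norm (res (Suc k)))\<^sup>2)
        + 2 * (\<sigma> * (norm ?b)\<^sup>2)"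
      by (simp add: algebra_simps)
    also have "\<dots> \<le> 4 * (\<rho> * decrease (Suc k)) + 4 * (\<rho> * decrease k) + 2 * (\<gamma> * decrease (Suc k))"
      using res_le[of k] res_le[of "Suc k"] coupling_le[of "Suc k"] by linarith
    finally have "\<mu> * (norm (x (Suc (Suc k)) - x (Suc k)))\<^sup>2
        \<le> 6 * decrease (Suc k) + 4 * (\<rho> * decrease (Suc k)) + 4 * (\<rho> * decrease k) + 2 * (\<gamma> * decrease (Suc k))"
      using \<mu>(2)[of "x (Suc (Suc k)) - x (Suc k)"] parts(1,2)[of "Suc k"]
      by (simp add: op_sqnorm_def inner_add_right inner_compose_adjoint[OF A])
    also have "\<dots> \<le> (6 + 4 * \<rho> + 2 * \<gamma>) * ?D"
      using decrease_bounds(1)[of k] pos mult_nonneg_nonneg[of \<gamma> "decrease k"] by (simp add: algebra_simps)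
    finally show ?thesis
      using \<mu>(1) by (simp only: Cx_def times_divide_eq_left pos_le_divide_eq mult.commute[of _ \<mu>])
  qed
  have y_bound: "(norm (y (Suc k) - y k))\<^sup>2 \<le> Cy * decrease k" for k
  proof -
    have "\<kappa> * (norm (y (Suc k) - y k))\<^sup>2 \<le> 6 * decrease k + \<gamma> * decrease k"
      using \<kappa>(2)[of "y (Suc k) - y k"] parts(3,4)[of k] coupling_le[of k]
      by (simp add: op_sqnorm_def inner_add_right inner_compose_adjoint[OF B])
    then show ?thesis
      using \<kappa>(1) by (simp add: Cy_def pos_le_divide_eq algebra_simps)
  qed
  have r_bound: "(norm (res (Suc k)))\<^sup>2 \<le> \<rho> / \<sigma> * decrease k" for k
    using res_le[of k] \<sigma> by (simp add: field_simps)
  have C: "Cx \<le> C" "Cy \<le> C" "\<rho> / \<sigma> \<le> C"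
    using nonneg by (simp_all add: C_def)
  have "0 \<le> decrease (Suc k) + decrease k" for k
    by (simp add: decrease_bounds(1))
  then show ?thesis
    using that[of "sqrt C"] norm_le_sqrt_mult_sqrt[OF x_bound C(1)]
      norm_le_sqrt_mult_sqrt[OF y_bound C(2) decrease_bounds(1)]
      norm_le_sqrt_mult_sqrt[OF r_bound C(3) decrease_bounds(1)] by blast
qed

section \<open>Convergence of the energy and identification of the limit\<close>

lemma lyapunov_converges:
  assumes "(u, v, w) \<in> KKT_solutions p q Df Dg A B c"
  shows "convergent (lyapunov u v w)" and "decrease \<longlonglongrightarrow> 0"
proof -
  obtain K where K: "0 \<le> K" "\<And>k. norm (x (Suc k) - u) \<le> K * sqrt (lyapunov u v w k + decrease k)"
    "\<And>k. norm (y (Suc k) - v) \<le> K * sqrt (lyapunov u v w k + decrease k)"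
    "\<And>k. norm (y (Suc k) - y k) \<le> K * sqrt (lyapunov u v w k + decrease k)"
    using error_bounds[OF KKT_D(3)[OF assms]] by metis
  \<comment> \<open>The error \<open>dy (Suc k)\<close> counts twice: once against the KKT point and
    once in the difference of consecutive errors.\<close>
  define \<eta> where "\<eta> k = K * (norm (dx (Suc k)) + 2 * norm (dy (Suc k)) + norm (dy k))" for k
  have "summable (\<lambda>k. norm (dx (Suc k)))" "summable (\<lambda>k. norm (dy (Suc k)))"
    using dx dy summable_Suc_iff[of "\<lambda>k. norm (dx k)"] summable_Suc_iff[of "\<lambda>k. norm (dy k)"] by simp_all
  then have \<eta>: "summable \<eta>" "\<And>k. 0 \<le> \<eta> k"
    unfolding \<eta>_def using dy K(1) by (auto intro!: summable_mult summable_add)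
  have step: "lyapunov u v w (Suc k) + decrease (Suc k)
      \<le> lyapunov u v w k + \<eta> k * sqrt (lyapunov u v w (Suc k) + decrease (Suc k))" for k
  proof -
    let ?s = "sqrt (lyapunov u v w (Suc k) + decrease (Suc k))"
    have "dx (Suc k) \<bullet> (x (Suc (Suc k)) - u) \<le> norm (dx (Suc k)) * (K * ?s)"
      using norm_cauchy_schwarz K(2) by (meson mult_left_mono norm_ge_zero order_trans)
    moreover have "dy (Suc k) \<bullet> (y (Suc (Suc k)) - v) \<le> norm (dy (Suc k)) * (K * ?s)"
      using norm_cauchy_schwarz K(3) by (meson mult_left_mono norm_ge_zero order_trans)
    moreover have "(dy (Suc k) - dy k) \<bullet> (y (Suc (Suc k)) - y (Suc k)) \<le> (norm (dy (Suc k)) + norm (dy k)) * (K * ?s)"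
    proof -
      have "(dy (Suc k) - dy k) \<bullet> (y (Suc (Suc k)) - y (Suc k))
          \<le> norm (dy (Suc k) - dy k) * norm (y (Suc (Suc k)) - y (Suc k))"
        by (rule norm_cauchy_schwarz)
      also have "\<dots> \<le> (norm (dy (Suc k)) + norm (dy k)) * (K * ?s)"
        using K(4) by (intro mult_mono norm_triangle_ineq4) auto
      finally show ?thesis .
    qed
    ultimately show ?thesis
      using lyapunov_step[OF assms, of k] by (simp add: \<eta>_def algebra_simps)
  qed
  show "convergent (lyapunov u v w)" "decrease \<longlonglongrightarrow> 0"
    using perturbed_descent[where \<Phi> = "lyapunov u v w" and D = decrease and \<eta> = \<eta>,
        OF lyapunov_bounds(1) decrease_bounds(1) \<eta>(2,1) step] by this
qed

lemma steps_vanish: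
  assumes "decrease \<longlonglongrightarrow> 0"
  shows "(\<lambda>k. x (Suc k) - x k) \<longlonglongrightarrow> 0" "(\<lambda>k. y (Suc k) - y k) \<longlonglongrightarrow> 0"
    "(\<lambda>k. z (Suc k) - z k) \<longlonglongrightarrow> 0" "(\<lambda>k. res (Suc k)) \<longlonglongrightarrow> 0"
proof -
  obtain K where K:
    "\<And>k. norm (x (Suc (Suc k)) - x (Suc k)) \<le> K * sqrt (decrease (Suc k) + decrease k)"
    "\<And>k. norm (y (Suc k) - y k) \<le> K * sqrt (decrease k)"
    "\<And>k. norm (res (Suc k)) \<le> K * sqrt (decrease k)"
    using step_bounds by blast
  have "(\<lambda>k. K * sqrt (decrease (Suc k) + decrease k)) \<longlonglongrightarrow> K * sqrt (0 + 0)"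
    by (intro tendsto_intros LIMSEQ_Suc assms)
  then have "(\<lambda>k. K * sqrt (decrease (Suc k) + decrease k)) \<longlonglongrightarrow> 0"
    by simp
  then have "(\<lambda>k. x (Suc (Suc k)) - x (Suc k)) \<longlonglongrightarrow> 0"
    by (rule Lim_null_comparison[OF always_eventually[OF allI[OF K(1)]]])
  then show "(\<lambda>k. x (Suc k) - x k) \<longlonglongrightarrow> 0"
    by (rule LIMSEQ_imp_Suc)
  have "(\<lambda>k. K * sqrt (decrease k)) \<longlonglongrightarrow> K * sqrt 0"
    by (intro tendsto_intros assms)
  then have null: "(\<lambda>k. K * sqrt (decrease k)) \<longlonglongrightarrow> 0"
    by simp
  show "(\<lambda>k. y (Suc k) - y k) \<longlonglongrightarrow> 0"
    by (rule Lim_null_comparison[OF always_eventually[OF allI[OF K(2)]] null])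
  show r: "(\<lambda>k. res (Suc k)) \<longlonglongrightarrow> 0"
    by (rule Lim_null_comparison[OF always_eventually[OF allI[OF K(3)]] null])
  have "(\<lambda>k. (\<tau> * \<sigma>) *\<^sub>R res (Suc k)) \<longlonglongrightarrow> (\<tau> * \<sigma>) *\<^sub>R 0"
    by (intro tendsto_intros r)
  then show "(\<lambda>k. z (Suc k) - z k) \<longlonglongrightarrow> 0"
    by (simp add: z_step)
qed

text \<open>The inclusion at index \<open>Suc (s j)\<close> has its subgradient at the following
  iterate but its gradient at the current one. As steps vanish, both have the same limit, and the
  closed graph of the subdifferential applies.\<close>

lemma cluster_point_KKT:
  assumes D: "decrease \<longlonglongrightarrow> 0" and s: "strict_mono s"
    and lim: "(\<lambda>j. x (Suc (s j))) \<longlonglongrightarrow> u" "(\<lambda>j. y (Suc (s j))) \<longlonglongrightarrow> v" "(\<lambda>j. z (Suc (s j))) \<longlonglongrightarrow> w"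
  shows "(u, v, w) \<in> KKT_solutions p q Df Dg A B c"
proof -
  note steps = steps_vanish[OF D]
  have sub: "(\<lambda>j. h (Suc (s j))) \<longlonglongrightarrow> 0" if "h \<longlonglongrightarrow> 0" for h :: "nat \<Rightarrow> 'w::real_normed_vector"
    using LIMSEQ_subseq_LIMSEQ[OF LIMSEQ_Suc[OF that] s] by (simp add: o_def)
  have x2: "(\<lambda>j. x (Suc (Suc (s j)))) \<longlonglongrightarrow> u"
    using tendsto_add[OF lim(1) sub[OF steps(1)]] by simp
  have y2: "(\<lambda>j. y (Suc (Suc (s j)))) \<longlonglongrightarrow> v"
    using tendsto_add[OF lim(2) sub[OF steps(2)]] by simp
  note r = sub[OF steps(4)]
  have zero: "dx \<longlonglongrightarrow> 0" "dy \<longlonglongrightarrow> 0"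
    using dx dy by (auto dest: summable_LIMSEQ_zero simp: tendsto_norm_zero_iff)
  have grad: "(\<lambda>j. Df (x (Suc (s j)))) \<longlonglongrightarrow> Df u" "(\<lambda>j. Dg (y (Suc (s j)))) \<longlonglongrightarrow> Dg v"
    using Df Dg lim(1,2) by (auto intro: continuous_on_tendsto_compose)
  let ?vx = "\<lambda>k. dx k - Df (x k) - A (z k + \<sigma> *\<^sub>R (res (Suc k) - adjoint B (y (Suc k) - y k))) - P (x (Suc k) - x k)"
  have "(\<lambda>j. ?vx (Suc (s j))) \<longlonglongrightarrow> 0 - Df u - A (w + \<sigma> *\<^sub>R (0 - adjoint B 0)) - P 0"
    by (intro tendsto_intros tendsto_operators grad lim r sub steps zero)
  then have "(\<lambda>j. ?vx (Suc (s j))) \<longlonglongrightarrow> - Df u - A w"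
    by (simp add: linear_0[OF linear_PQ(1)] linear_0[OF linear_adjoints(2)])
  then have "- Df u - A w \<in> subdifferential p u"
    using subdifferential_closed_graph[OF p x_step x2] by blast
  moreover
  let ?vy = "\<lambda>k. dy k - Dg (y k) - B (z k + \<sigma> *\<^sub>R res (Suc k)) - Q (y (Suc k) - y k)"
  have "(\<lambda>j. ?vy (Suc (s j))) \<longlonglongrightarrow> 0 - Dg v - B (w + \<sigma> *\<^sub>R 0) - Q 0"
    by (intro tendsto_intros tendsto_operators grad lim r sub steps zero)
  then have "(\<lambda>j. ?vy (Suc (s j))) \<longlonglongrightarrow> - Dg v - B w"
    by (simp add: linear_0[OF linear_PQ(2)])
  then have "- Dg v - B w \<in> subdifferential q v"
    using subdifferential_closed_graph[OF q y_step y2] by blast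
  moreover have "adjoint A u + adjoint B v = c"
  proof -
    have "(\<lambda>j. res (Suc (Suc (s j)))) \<longlonglongrightarrow> adjoint A u + adjoint B v - c"
      unfolding res by (intro tendsto_intros tendsto_operators x2 y2)
    then show ?thesis
      using LIMSEQ_unique[OF r] by fastforce
  qed
  ultimately show ?thesis
    unfolding KKT_solutions_def by force
qed

lemma lyapunov_subseq_vanishes:
  assumes D: "decrease \<longlonglongrightarrow> 0" and s: "strict_mono s"
    and lim: "(\<lambda>j. x (Suc (s j))) \<longlonglongrightarrow> u" "(\<lambda>j. y (Suc (s j))) \<longlonglongrightarrow> v" "(\<lambda>j. z (Suc (s j))) \<longlonglongrightarrow> w"
  shows "(\<lambda>j. lyapunov u v w (s j)) \<longlonglongrightarrow> 0"
proof -
  have sub: "(\<lambda>j. h (s j)) \<longlonglongrightarrow> 0" if "h \<longlonglongrightarrow> 0" for h :: "nat \<Rightarrow> 'w::real_normed_vector"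
    using LIMSEQ_subseq_LIMSEQ[OF that s] by (simp add: o_def)
  have "(\<lambda>j. lyapunov u v w (s j)) \<longlonglongrightarrow>
      ((u - u) \<bullet> P (u - u)) / 2 + ((v - v) \<bullet> Q (v - v)) / 2
      + \<sigma> / 2 * (norm (adjoint B (v - v)))\<^sup>2 + (norm (w - w))\<^sup>2 / (2 * \<tau> * \<sigma>)
      + (0 \<bullet> Q 0) / 2 + \<sigma> / 2 * residual_weight \<tau> * (norm (0::'z))\<^sup>2"
    unfolding lyapunov_def op_sqnorm_def
    by (intro tendsto_intros tendsto_operators lim sub steps_vanish[OF D])
      (use \<sigma> \<tau> in auto)
  then show ?thesis
    by (simp add: linear_0[OF linear_adjoints(2)])
qed

text \<open>An arbitrary KKT point serves first, to bound the iterates. A cluster point, being a KKT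
  point itself, then replaces it as reference.\<close>

lemma iterates_converge:
  assumes "KKT_solutions p q Df Dg A B c \<noteq> {}"
  shows "\<exists>w \<in> KKT_solutions p q Df Dg A B c. (\<lambda>k. (x k, y k, z k)) \<longlonglongrightarrow> w"
proof -
  obtain u\<^sub>0 v\<^sub>0 w\<^sub>0 where w0: "(u\<^sub>0, v\<^sub>0, w\<^sub>0) \<in> KKT_solutions p q Df Dg A B c"
    using assms by auto
  note D = lyapunov_converges(2)[OF w0]
  define E where "E u v w k = lyapunov u v w k + decrease k" for u v w k
  obtain K where K: "0 \<le> K" "\<And>k. norm (x (Suc k) - u\<^sub>0) \<le> K * sqrt (E u\<^sub>0 v\<^sub>0 w\<^sub>0 k)"
    "\<And>k. norm (y (Suc k) - v\<^sub>0) \<le> K * sqrt (E u\<^sub>0 v\<^sub>0 w\<^sub>0 k)"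
    "\<And>k. norm (z (Suc k) - w\<^sub>0) \<le> K * sqrt (E u\<^sub>0 v\<^sub>0 w\<^sub>0 k)"
    using error_bounds[OF KKT_D(3)[OF w0]] unfolding E_def by metis
  have "convergent (\<lambda>k. K * sqrt (E u\<^sub>0 v\<^sub>0 w\<^sub>0 k))"
  proof -
    obtain L where "lyapunov u\<^sub>0 v\<^sub>0 w\<^sub>0 \<longlonglongrightarrow> L"
      using lyapunov_converges(1)[OF w0] by (auto simp: convergent_def)
    then have "(\<lambda>k. K * sqrt (E u\<^sub>0 v\<^sub>0 w\<^sub>0 k)) \<longlonglongrightarrow> K * sqrt (L + 0)"
      unfolding E_def by (intro tendsto_intros D)
    then show ?thesis
      by (auto simp: convergent_def)
  qed
  then obtain b where b: "\<And>k. norm (K * sqrt (E u\<^sub>0 v\<^sub>0 w\<^sub>0 k)) \<le> b"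
    using convergent_imp_Bseq BseqE by blast
  have "x (Suc k) \<in> cball u\<^sub>0 b" "y (Suc k) \<in> cball v\<^sub>0 b" "z (Suc k) \<in> cball w\<^sub>0 b" for k
    using K(2-4)[of k] b[of k] by (auto simp: dist_norm norm_minus_commute)
  then have "\<forall>k. (x (Suc k), y (Suc k), z (Suc k)) \<in> cball u\<^sub>0 b \<times> cball v\<^sub>0 b \<times> cball w\<^sub>0 b"
    by blast
  moreover have "seq_compact (cball u\<^sub>0 b \<times> cball v\<^sub>0 b \<times> cball w\<^sub>0 b)"
    by (intro compact_imp_seq_compact compact_Times compact_cball)
  ultimately obtain l s where s: "strict_mono s"
    and l: "((\<lambda>k. (x (Suc k), y (Suc k), z (Suc k))) \<circ> s) \<longlonglongrightarrow> l"
    by (meson seq_compactE)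
  obtain u v w where uvw: "l = (u, v, w)"
    using prod_cases3 by blast
  have lim: "(\<lambda>j. x (Suc (s j))) \<longlonglongrightarrow> u" "(\<lambda>j. y (Suc (s j))) \<longlonglongrightarrow> v" "(\<lambda>j. z (Suc (s j))) \<longlonglongrightarrow> w"
    using tendsto_fst[OF l] tendsto_fst[OF tendsto_snd[OF l]] tendsto_snd[OF tendsto_snd[OF l]]
    by (simp_all add: uvw o_def)
  have KKT: "(u, v, w) \<in> KKT_solutions p q Df Dg A B c"
    using D s lim by (rule cluster_point_KKT)
  \<comment> \<open>The whole energy sequence at the new reference converges, so its limit can be
    read off along the subsequence, where it is 0.\<close>
  obtain L where L: "lyapunov u v w \<longlonglongrightarrow> L"
    using lyapunov_converges(1)[OF KKT] by (auto simp: convergent_def)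
  have "(\<lambda>j. lyapunov u v w (s j)) \<longlonglongrightarrow> L"
    using LIMSEQ_subseq_LIMSEQ[OF L s] by (simp add: o_def)
  then have "L = 0"
    using lyapunov_subseq_vanishes[OF D s lim] by (rule LIMSEQ_unique)
  obtain K' where K': "\<And>k. norm (x (Suc k) - u) \<le> K' * sqrt (E u v w k)"
    "\<And>k. norm (y (Suc k) - v) \<le> K' * sqrt (E u v w k)"
    "\<And>k. norm (z (Suc k) - w) \<le> K' * sqrt (E u v w k)"
    using error_bounds[OF KKT_D(3)[OF KKT]] unfolding E_def by metis
  have "(\<lambda>k. K' * sqrt (E u v w k)) \<longlonglongrightarrow> K' * sqrt (L + 0)"
    unfolding E_def by (intro tendsto_intros L D)
  then have *: "(\<lambda>k. K' * sqrt (E u v w k)) \<longlonglongrightarrow> 0"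
    by (simp add: \<open>L = 0\<close>)
  have conv: "h \<longlonglongrightarrow> a" if "\<And>k. norm (h (Suc k) - a) \<le> K' * sqrt (E u v w k)"
    for h :: "nat \<Rightarrow> 'w::real_normed_vector" and a
  proof -
    have "(\<lambda>k. h (Suc k) - a) \<longlonglongrightarrow> 0"
      by (rule Lim_null_comparison[OF always_eventually[OF allI[OF that]] *])
    then show ?thesis
      by (simp add: LIM_zero_iff filterlim_sequentially_Suc)
  qed
  have "(\<lambda>k. (x k, y k, z k)) \<longlonglongrightarrow> (u, v, w)"
    by (intro tendsto_Pair conv K')
  then show ?thesis
    using KKT by blast
qed

end

section \<open>Reduction to subgradient inclusions\<close>

text \<open>The coupling part of \<open>M\<close> applied to \<open>u' - u\<close> merges with the
  linearized penalty term: the residual \<open>r\<close> at the old point becomes the one updated by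
  the new \<open>u'\<close>, and only \<open>P\<close> remains as proximal operator.\<close>

lemma inexact_prox_step_inclusion:
  fixes A :: "'z::euclidean_space \<Rightarrow> 'a::euclidean_space"
  assumes h: "closed_proper_convex_on UNIV h" and A: "linear A" and P: "self_adjoint P"
    and M: "M = (\<lambda>u. P u + \<sigma> *\<^sub>R A (adjoint A u))"
    and d: "d \<in> subdifferential (\<lambda>v. h v + ereal (1/2 * (v \<bullet> M v) - (- (a - M u + \<sigma> *\<^sub>R A r)) \<bullet> v)) u'"
  shows "d - a - \<sigma> *\<^sub>R A (r + adjoint A (u' - u)) - P (u' - u) \<in> subdifferential h u'"
proof -
  have "self_adjoint M"
    unfolding M using P self_adjoint_compose_adjoint[OF A] by (intro self_adjoint_add self_adjoint_scaleR)
  from subdifferential_quadratic_perturbation[OF h this d]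
  have "d - M u' + - (a - M u + \<sigma> *\<^sub>R A r) \<in> subdifferential h u'" .
  also have "d - M u' + - (a - M u + \<sigma> *\<^sub>R A r) = d - a - \<sigma> *\<^sub>R A (r + adjoint A (u' - u)) - P (u' - u)"
    by (simp add: M linear_diff[OF self_adjoint_imp_linear[OF P]] linear_diff[OF adjoint_linear[OF A]]
        linear_add[OF A] linear_diff[OF A] algebra_simps)
  finally show ?thesis .
qed

lemma inexact_prox_steps_summable:
  fixes h :: "'a::euclidean_space \<Rightarrow> ereal"
  assumes M: "pd_op M" and step: "\<And>k. inexact_prox_step h M (l k) (\<epsilon> k) (u k)" and \<epsilon>: "summable \<epsilon>"
  obtains d where
    "\<And>k. d k \<in> subdifferential (\<lambda>v. h v + ereal (1/2 * (v \<bullet> M v) - l k \<bullet> v)) (u k)"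
    "summable (\<lambda>k. norm (d k))"
proof -
  obtain d where d: "\<And>k. d k \<in> subdifferential (\<lambda>v. h v + ereal (1/2 * (v \<bullet> M v) - l k \<bullet> v)) (u k)"
    "\<And>k. norm (inv (op_sqrt M) (d k)) \<le> \<epsilon> k"
    using step unfolding inexact_prox_step_def Bex_def by metis
  obtain C where C: "0 \<le> C" "\<And>d. norm d \<le> C * norm (inv (op_sqrt M) d)"
    using norm_le_inv_op_sqrt[OF M] by blast
  have "norm (norm (d k)) \<le> C * \<epsilon> k" for k
    using order_trans[OF C(2) mult_left_mono[OF d(2) C(1)]] by simp
  then have "summable (\<lambda>k. norm (d k))"
    by (rule summable_comparison_test'[OF summable_mult[OF \<epsilon>], of 0 "\<lambda>k. norm (d k)" C])
  with d(1) show ?thesis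
    using that by blast
qed

section \<open>Positive definiteness of the operators in the conclusion\<close>

text \<open>Three nonnegative forms whose combination is positive at \<open>u\<close> cannot all
  vanish there, so any combination with positive weights is positive too.\<close>

lemma pd_op_reweight:
  assumes "psd_op H" "psd_op S" "psd_op K" "pd_op (\<lambda>u. H u + S u + t *\<^sub>R K u)" "0 < r" "0 < s"
  shows "pd_op (\<lambda>u. r *\<^sub>R H u + S u + s *\<^sub>R K u)"
  unfolding pd_op_def
proof (intro conjI allI impI)
  show "self_adjoint (\<lambda>u. r *\<^sub>R H u + S u + s *\<^sub>R K u)"
    using assms(1-3) by (intro self_adjoint_add self_adjoint_scaleR psd_op_imp_self_adjoint)
  fix u :: 'a assume "u \<noteq> 0"
  then have pos: "0 < u \<bullet> H u + u \<bullet> S u + t * (u \<bullet> K u)"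
    using assms(4) by (simp add: pd_op_def inner_add_right)
  have nonneg: "0 \<le> u \<bullet> H u" "0 \<le> u \<bullet> S u" "0 \<le> u \<bullet> K u"
    using assms(1-3) by (simp_all add: psd_op_def)
  with pos have "0 < u \<bullet> H u \<or> 0 < u \<bullet> S u \<or> 0 < u \<bullet> K u"
    by (cases "u \<bullet> K u = 0") auto
  then have "0 < r * (u \<bullet> H u) \<or> 0 < u \<bullet> S u \<or> 0 < s * (u \<bullet> K u)"
    using assms(5,6) by (metis mult_pos_pos)
  moreover have "0 \<le> r * (u \<bullet> H u)" "0 \<le> s * (u \<bullet> K u)"
    using nonneg assms(5,6) by simp_all
  ultimately show "0 < u \<bullet> (r *\<^sub>R H u + S u + s *\<^sub>R K u)"
    unfolding inner_add_right inner_scaleR_right using nonneg(2) by linarith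
qed

lemma psd_op_compose_adjoint:
  fixes A :: "'z::euclidean_space \<Rightarrow> 'a::euclidean_space"
  assumes "linear A"
  shows "psd_op (\<lambda>u. A (adjoint A u))"
  using self_adjoint_compose_adjoint[OF assms] by (simp add: psd_op_def inner_compose_adjoint[OF assms])

text \<open>The condition \<open>\<tau>\<^sup>2 < 1 + \<tau>\<close> is equivalent to
  \<open>\<tau> < 1 + 1 / \<tau>\<close>, so the quotient lies strictly between 0 and 1, and
  \<open>imsPADMM_alpha \<tau>\<close> is its average with 1.\<close>

lemma imsPADMM_alpha_bounds:
  assumes "0 < \<tau>" "\<tau>\<^sup>2 < 1 + \<tau>"
  shows "0 < imsPADMM_alpha \<tau>" "imsPADMM_alpha \<tau> < 1"
proof -
  define m where "m = min (1 + \<tau>) (1 + 1 / \<tau>)"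
  have "\<tau> < m"
    using assms by (simp add: m_def field_simps power2_eq_square)
  then have "0 < \<tau> / m" "\<tau> / m < 1"
    using assms by (simp_all add: field_simps)
  then show "0 < imsPADMM_alpha \<tau>" "imsPADMM_alpha \<tau> < 1"
    unfolding imsPADMM_alpha_def m_def[symmetric] by simp_all
qed

theorem theorem5p1:
  fixes m n :: nat
    and X :: "nat \<Rightarrow> 'x::euclidean_space set" and Y :: "nat \<Rightarrow> 'y::euclidean_space set"
    and p\<^sub>1 p :: "'x \<Rightarrow> ereal" and q\<^sub>1 q :: "'y \<Rightarrow> ereal"
    and f :: "'x \<Rightarrow> real" and g :: "'y \<Rightarrow> real"
    and Df :: "'x \<Rightarrow> 'x" and Dg :: "'y \<Rightarrow> 'y"
    and A :: "'z::euclidean_space \<Rightarrow> 'x" and B :: "'z \<Rightarrow> 'y" and c :: 'z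
    and Sf Sf' S :: "'x \<Rightarrow> 'x" and Sg Sg' T :: "'y \<Rightarrow> 'y"
    and \<sigma> \<tau> \<alpha> :: real and \<epsilon> :: "nat \<Rightarrow> real"
    and x :: "nat \<Rightarrow> 'x" and y :: "nat \<Rightarrow> 'y" and z :: "nat \<Rightarrow> 'z"
  assumes "block_product m X" and "block_product n Y"
    and "closed_proper_convex_on (X 1) p\<^sub>1" and "closed_proper_convex_on (Y 1) q\<^sub>1"
    and p: "p = (\<lambda>u. p\<^sub>1 (block_component m X 1 u))"
    and q: "q = (\<lambda>v. q\<^sub>1 (block_component n Y 1 v))"
    and "convex_on UNIV f" and "\<And>u. GDERIV f u :> Df u" and "continuous_on UNIV Df"
    and "\<exists>L. L-lipschitz_on UNIV Df"
    and "convex_on UNIV g" and "\<And>v. GDERIV g v :> Dg v" and "continuous_on UNIV Dg"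
    and "\<exists>L. L-lipschitz_on UNIV Dg"
    and "linear A" and "linear B"
    and "psd_op Sf" and "psd_op Sf'" and "loewner_le Sf Sf'"
    and "psd_op Sg" and "psd_op Sg'" and "loewner_le Sg Sg'"
    and "\<And>u u'. 1/2 * op_sqnorm Sf (u - u') \<le> f u - f u' - Df u' \<bullet> (u - u')"
    and "\<And>u u'. f u - f u' - Df u' \<bullet> (u - u') \<le> 1/2 * op_sqnorm Sf' (u - u')"
    and "\<And>v v'. 1/2 * op_sqnorm Sg (v - v') \<le> g v - g v' - Dg v' \<bullet> (v - v')"
    and "\<And>v v'. g v - g v' - Dg v' \<bullet> (v - v') \<le> 1/2 * op_sqnorm Sg' (v - v')"
    and "0 < \<sigma>" and "0 < \<tau>" and "\<tau> < (1 + sqrt 5) / 2"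
    and "\<And>k. 0 \<le> \<epsilon> k" and "summable \<epsilon>"
    and "psd_op S" and "psd_op T"
    and "pd_op (\<lambda>u. Sf' u + S u + \<sigma> *\<^sub>R A (adjoint A u))"
    and "pd_op (\<lambda>v. Sg' v + T v + \<sigma> *\<^sub>R B (adjoint B v))"
    and "imsPADMM p q Df Dg A B c Sf' Sg' S T \<sigma> \<tau> \<epsilon> x y z"
    and "KKT_solutions p q Df Dg A B c \<noteq> {}"
    and "pd_op (\<lambda>u. Sf u + S u + \<sigma> *\<^sub>R A (adjoint A u))"
    and "pd_op (\<lambda>v. Sg v + T v + \<sigma> *\<^sub>R B (adjoint B v))"
    and \<alpha>: "\<alpha> = imsPADMM_alpha \<tau>"
  shows "pd_op (\<lambda>u. (1/2) *\<^sub>R Sf u + S u + ((1 - \<alpha>) * \<sigma> / 2) *\<^sub>R A (adjoint A u)) \<and>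
    pd_op (\<lambda>v. (1/2) *\<^sub>R Sg v + T v
           + (min \<tau> (1 + \<tau> - \<tau>\<^sup>2) * \<alpha> * \<sigma>) *\<^sub>R B (adjoint B v)) \<and>
    (\<exists>w \<in> KKT_solutions p q Df Dg A B c. (\<lambda>k. (x k, y k, z k)) \<longlonglongrightarrow> w)"
proof -
  have golden: "\<tau>\<^sup>2 < 1 + \<tau>"
    using \<open>0 < \<tau>\<close> \<open>\<tau> < (1 + sqrt 5) / 2\<close> by (rule golden_ratio_bound)
  note AA = psd_op_compose_adjoint[OF \<open>linear A\<close>] and BB = psd_op_compose_adjoint[OF \<open>linear B\<close>]
  note \<alpha>_bounds = imsPADMM_alpha_bounds[OF \<open>0 < \<tau>\<close> golden, folded \<alpha>]
  have F: "pd_op (\<lambda>u. (1/2) *\<^sub>R Sf u + S u + ((1 - \<alpha>) * \<sigma> / 2) *\<^sub>R A (adjoint A u))"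
    by (rule pd_op_reweight[OF \<open>psd_op Sf\<close> \<open>psd_op S\<close> AA
          \<open>pd_op (\<lambda>u. Sf u + S u + \<sigma> *\<^sub>R A (adjoint A u))\<close>])
      (use \<alpha>_bounds \<open>0 < \<sigma>\<close> in simp_all)
  have G: "pd_op (\<lambda>v. (1/2) *\<^sub>R Sg v + T v
      + (min \<tau> (1 + \<tau> - \<tau>\<^sup>2) * \<alpha> * \<sigma>) *\<^sub>R B (adjoint B v))"
    by (rule pd_op_reweight[OF \<open>psd_op Sg\<close> \<open>psd_op T\<close> BB
          \<open>pd_op (\<lambda>v. Sg v + T v + \<sigma> *\<^sub>R B (adjoint B v))\<close>])
      (use \<alpha>_bounds \<open>0 < \<sigma>\<close> coupling_gain_pos[OF \<open>0 < \<tau>\<close> golden] in \<open>simp_all add: coupling_gain_def\<close>)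
  have p_cpc: "closed_proper_convex_on UNIV p"
    unfolding p using \<open>block_product m X\<close> \<open>closed_proper_convex_on (X 1) p\<^sub>1\<close>
    by (rule closed_proper_convex_on_block_component)
  have q_cpc: "closed_proper_convex_on UNIV q"
    unfolding q using \<open>block_product n Y\<close> \<open>closed_proper_convex_on (Y 1) q\<^sub>1\<close>
    by (rule closed_proper_convex_on_block_component)
  define P where "P = (\<lambda>u. Sf' u + S u)"
  define Q where "Q = (\<lambda>v. Sg' v + T v)"
  define M where "M = (\<lambda>u. P u + \<sigma> *\<^sub>R A (adjoint A u))"
  define N where "N = (\<lambda>v. Q v + \<sigma> *\<^sub>R B (adjoint B v))"
  define res where "res = (\<lambda>k. adjoint A (x k) + adjoint B (y k) - c)"
  have PQ: "self_adjoint P" "self_adjoint Q"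
    unfolding P_def Q_def using \<open>psd_op Sf'\<close> \<open>psd_op S\<close> \<open>psd_op Sg'\<close> \<open>psd_op T\<close>
    by (auto intro: self_adjoint_add psd_op_imp_self_adjoint)
  have MN: "pd_op M" "pd_op N"
    unfolding M_def N_def P_def Q_def
    using \<open>pd_op (\<lambda>u. Sf' u + S u + \<sigma> *\<^sub>R A (adjoint A u))\<close> \<open>pd_op (\<lambda>v. Sg' v + T v + \<sigma> *\<^sub>R B (adjoint B v))\<close>
    by simp_all
  have run: "inexact_prox_step p M (- (Df (x k) + A (z k) - M (x k)
        + \<sigma> *\<^sub>R A (adjoint A (x k) + adjoint B (y k) - c))) (\<epsilon> k) (x (Suc k))"
    "inexact_prox_step q N (- (Dg (y k) + B (z k) - N (y k)
        + \<sigma> *\<^sub>R B (adjoint A (x (Suc k)) + adjoint B (y k) - c))) (\<epsilon> k) (y (Suc k))"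
    "z (Suc k) = z k + (\<tau> * \<sigma>) *\<^sub>R res (Suc k)" for k
    using \<open>imsPADMM p q Df Dg A B c Sf' Sg' S T \<sigma> \<tau> \<epsilon> x y z\<close>
    unfolding imsPADMM_def Let_def M_def N_def P_def Q_def res_def by blast+
  obtain dx where dx: "\<And>k. dx k \<in> subdifferential (\<lambda>v. p v + ereal (1/2 * (v \<bullet> M v)
      - (- (Df (x k) + A (z k) - M (x k) + \<sigma> *\<^sub>R A (adjoint A (x k) + adjoint B (y k) - c))) \<bullet> v)) (x (Suc k))"
    and dx_sum: "summable (\<lambda>k. norm (dx k))"
    using inexact_prox_steps_summable[OF MN(1) run(1) \<open>summable \<epsilon>\<close>] by blast
  obtain dy where dy: "\<And>k. dy k \<in> subdifferential (\<lambda>v. q v + ereal (1/2 * (v \<bullet> N v)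
      - (- (Dg (y k) + B (z k) - N (y k) + \<sigma> *\<^sub>R B (adjoint A (x (Suc k)) + adjoint B (y k) - c))) \<bullet> v)) (y (Suc k))"
    and dy_sum: "summable (\<lambda>k. norm (dy k))"
    using inexact_prox_steps_summable[OF MN(2) run(2) \<open>summable \<epsilon>\<close>] by blast
  have x_incl: "dx k - Df (x k) - A (z k + \<sigma> *\<^sub>R (res (Suc k) - adjoint B (y (Suc k) - y k)))
      - P (x (Suc k) - x k) \<in> subdifferential p (x (Suc k))" for k
  proof -
    \<comment> \<open>During the \<open>x\<close>-step \<open>y\<close> still has its old value, so
      the updated residual there is the new one without the change in \<open>y\<close>.\<close>
    have "res (Suc k) - adjoint B (y (Suc k) - y k)
        = (adjoint A (x k) + adjoint B (y k) - c) + adjoint A (x (Suc k) - x k)"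
      by (simp add: res_def linear_diff[OF adjoint_linear[OF \<open>linear A\<close>]] linear_diff[OF adjoint_linear[OF \<open>linear B\<close>]])
    then show ?thesis
      using inexact_prox_step_inclusion[OF p_cpc \<open>linear A\<close> PQ(1) M_def dx]
      by (simp only: linear_add[OF \<open>linear A\<close>, of "z k"] linear_scale[OF \<open>linear A\<close>] diff_diff_eq add.assoc)
  qed
  have y_incl: "dy k - Dg (y k) - B (z k + \<sigma> *\<^sub>R res (Suc k))
      - Q (y (Suc k) - y k) \<in> subdifferential q (y (Suc k))" for k
  proof -
    have "res (Suc k) = (adjoint A (x (Suc k)) + adjoint B (y k) - c) + adjoint B (y (Suc k) - y k)"
      by (simp add: res_def linear_diff[OF adjoint_linear[OF \<open>linear B\<close>]])
    then show ?thesis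
      using inexact_prox_step_inclusion[OF q_cpc \<open>linear B\<close> PQ(2) N_def dy]
      by (simp only: linear_add[OF \<open>linear B\<close>, of "z k"] linear_scale[OF \<open>linear B\<close>] diff_diff_eq add.assoc)
  qed
  interpret imsPADMM_run p q f g Df Dg A B c Sf Sf' S P Sg Sg' T Q \<sigma> \<tau> dx x dy y z res
    by (rule imsPADMM_run.intro) (fact p_cpc q_cpc assms golden P_def Q_def res_def x_incl y_incl run(3) dx_sum dy_sum)+
  show ?thesis
    using F G iterates_converge[OF \<open>KKT_solutions p q Df Dg A B c \<noteq> {}\<close>] by blast
qed

end
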